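(* Let $\gamma:I\to M$ be a unit speed curve in a spacelike hypersurface $M\subset\mathbb{R}^4_1$ such that $k_g(s)\neq0$, $(k_n\tau_2+k_g\tau_g)(s)\neq0$ and $k_g^2(s)>k_n^2(s)$ for any $s\in I$. Let $S_\gamma(s,\theta(s))$, $s\in I$, be the singular points of the hyperbolic surface $S_\gamma$ of $\gamma$, where $\theta:I\to\mathbb{R}$ is given by $$\tanh\theta(s)=\frac{k_gk_n'+k_g^2\tau_1-k_n^2\tau_1-k_nk_g'}{(k_n\tau_2+k_g\tau_g)\sqrt{k_g^2-k_n^2}}(s)$$ (the right-hand side being assumed to lie in $(-1,1)$ for all $s\in I$). Then the following conditions are equivalent: (1) $S_\gamma(s,\theta(s))$ is a constant timelike vector (independent of $s\in I$); (2) $\rho(s)=0$ for all $s\in I$; (3) there exist a timelike vector $v$ and a real number $c$ such that $\gamma(I)\subset M\cap HP(v,c)$.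
   Context: $\mathbb{R}^4_1$ is $\mathbb{R}^4$ with $\langle x,y\rangle=-x_0y_0+x_1y_1+x_2y_2+x_3y_3$; a nonzero vector $x$ is spacelike, lightlike or timelike if $\langle x,x\rangle$ is $>0$, $=0$ or $<0$; $\|x\|=\sqrt{|\langle x,x\rangle|}$. With $\{e_0,e_1,e_2,e_3\}$ the canonical basis, $x\wedge y\wedge z$ is the formal determinant with rows $(-e_0,e_1,e_2,e_3),x,y,z$. For $v\ne0$ and $c\in\mathbb{R}$, $HP(v,c)=\{x\in\mathbb{R}^4_1\mid\langle x,v\rangle=c\}$. $H^3(-1)=\{x\in\mathbb{R}^4_1\mid\langle x,x\rangle=-1\}$. $U\subset\mathbb{R}^3$ is open, $X:U\to\mathbb{R}^4_1$ is a smooth embedding all of whose nonzero tangent vectors are spacelike, $M=X(U)$ (a spacelike hypersurface), and $n$ is the unit timelike normal field along $M$ which is future directed ($\langle n,e_0\rangle<0$). $I$ is an open interval and $\gamma=X\circ\bar\gamma:I\to M$, with $\bar\gamma:I\to U$ a smooth regular curve, is parametrized by arc length ("unit speed"). Put $t=\gamma'$, $n_\gamma(s)=n(\gamma(s))$, $k_n=-\langle n_\gamma,t'\rangle$, $k_g=\|t'-k_nn_\gamma\|$ and, when $k_g\ne0$ (so $k_g>0$), $n_1=(t'-k_nn_\gamma)/k_g$, $n_2=n_\gamma\wedge t\wedge n_1$, $\tau_1=\langle n_1,n_\gamma'\rangle$, $\tau_2=\langle n_2,n_\gamma'\rangle$, $\tau_g=-\langle n_2',n_1\rangle$. Then $\{n_\gamma,t,n_1,n_2\}$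 is a pseudo-orthonormal frame along $\gamma$ with $n_\gamma'=k_nt+\tau_1n_1+\tau_2n_2$, $t'=k_nn_\gamma+k_gn_1$, $n_1'=\tau_1n_\gamma-k_gt+\tau_gn_2$, $n_2'=\tau_2n_\gamma-\tau_gn_1$. The hyperbolic surface of $\gamma$ is $S_\gamma:I\times\mathbb{R}\to H^3(-1)$, $$S_\gamma(s,\theta)=\frac{\cosh\theta}{\sqrt{k_g^2(s)-k_n^2(s)}}\bigl(k_g(s)n_\gamma(s)+k_n(s)n_1(s)\bigr)+\sinh\theta\,n_2(s).$$ The invariant $\rho$ is $$\begin{aligned}\rho=\;&(-k_gk_n''-k_gk_n\tau_2^2-2k_gk_g'\tau_1-k_g^2\tau_1'-k_g^2\tau_g\tau_2+2k_nk_n'\tau_1+k_n^2\tau_1'-k_n^2\tau_g\tau_2+k_g''k_n-k_gk_n\tau_g^2)(k_n\tau_2+k_g\tau_g)\\&+(k_gk_n'+k_g^2\tau_1-k_n^2\tau_1-k_nk_g')(2k_n'\tau_2+k_n\tau_1\tau_g+k_n\tau_2'+2k_g'\tau_g+k_g\tau_1\tau_2+k_g\tau_g').\end{aligned}$$ *)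

theory Defs
  imports "HOL-Analysis.Analysis"
begin

section \<open>Minkowski space\<close>

text \<open>
  Minkowski 4-space is modelled on \<open>real ^ 4\<close>, with coordinates \<open>x $ 0\<close>, \<open>x $ 1\<close>,
  \<open>x $ 2\<close>, \<open>x $ 3\<close>. The elements of the index type \<open>4\<close> are the residues modulo 4, so
  that the index \<open>0\<close> is the one that the library usually writes as \<open>4\<close>.
\<close>

definition lorentz :: "real ^ 4 \<Rightarrow> real ^ 4 \<Rightarrow> real" where
  "lorentz x y = - (x $ 0 * y $ 0) + x $ 1 * y $ 1 + x $ 2 * y $ 2 + x $ 3 * y $ 3"

definition spacelike :: "real ^ 4 \<Rightarrow> bool" where
  "spacelike x \<longleftrightarrow> lorentz x x > 0"

definition timelike :: "real ^ 4 \<Rightarrow> bool" where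
  "timelike x \<longleftrightarrow> lorentz x x < 0"

definition lorentz_norm :: "real ^ 4 \<Rightarrow> real" where
  "lorentz_norm x = sqrt \<bar>lorentz x x\<bar>"

text \<open>
  The formal determinant with rows \<open>(-e\<^sub>0, e\<^sub>1, e\<^sub>2, e\<^sub>3)\<close>, \<open>x\<close>, \<open>y\<close>, \<open>z\<close>: its
  \<open>i\<close>-th component is the real determinant in which the first row is replaced by the
  \<open>i\<close>-th components of \<open>-e\<^sub>0, e\<^sub>1, e\<^sub>2, e\<^sub>3\<close>. The rows are given by index rather than by
  \<^const>\<open>vector\<close>, whose first entry has index 1: that would permute the rows against the
  columns cyclically and reverse the sign.
\<close>

definition wedge :: "real ^ 4 \<Rightarrow> real ^ 4 \<Rightarrow> real ^ 4 \<Rightarrow> real ^ 4" where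
  "wedge x y z =
     (\<chi> i. det ((\<chi> r. if r = 0 then (if i = 0 then - axis 0 1 else axis i 1)
                     else if r = 1 then x
                     else if r = 2 then y
                     else z) :: real ^ 4 ^ 4))"

definition HP :: "real ^ 4 \<Rightarrow> real \<Rightarrow> (real ^ 4) set" where
  "HP v c = {x. lorentz x v = c}"


section \<open>Smooth maps, spacelike hypersurfaces and singular points\<close>

text \<open>
  On an open subset of a finite-dimensional space, all directional derivatives being of
  class \<open>C\<^sup>k\<close> is the same as the derivative being of class \<open>C\<^sup>k\<close>.
\<close>

primrec Ck_on :: "nat \<Rightarrow> 'a::euclidean_space set \<Rightarrow> ('a \<Rightarrow> 'b::real_normed_vector) \<Rightarrow> bool" where
  "Ck_on 0 S f \<longleftrightarrow> continuous_on S f"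
| "Ck_on (Suc k) S f \<longleftrightarrow>
     (\<forall>x\<in>S. f differentiable (at x)) \<and>
     (\<forall>v. Ck_on k S (\<lambda>x. frechet_derivative f (at x) v))"

definition smooth_on :: "'a::euclidean_space set \<Rightarrow> ('a \<Rightarrow> 'b::real_normed_vector) \<Rightarrow> bool" where
  "smooth_on S f \<longleftrightarrow> (\<forall>k. Ck_on k S f)"

definition smooth_embedding_on ::
    "'a::euclidean_space set \<Rightarrow> ('a \<Rightarrow> 'b::real_normed_vector) \<Rightarrow> bool" where
  "smooth_embedding_on U X \<longleftrightarrow>
     smooth_on U X \<and>
     (\<forall>u\<in>U. inj (frechet_derivative X (at u))) \<and>
     (\<exists>Y. homeomorphism U (X ` U) X Y)"

definition spacelike_embedding_on :: "(real ^ 3) set \<Rightarrow> (real ^ 3 \<Rightarrow> real ^ 4) \<Rightarrow> bool" where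
  "spacelike_embedding_on U X \<longleftrightarrow>
     smooth_embedding_on U X \<and>
     (\<forall>u\<in>U. \<forall>w. frechet_derivative X (at u) w \<noteq> 0 \<longrightarrow>
                  spacelike (frechet_derivative X (at u) w))"

text \<open>
  The field \<open>n\<close> is a function of the point of the hypersurface. These conditions determine
  it uniquely on \<open>X ` U\<close>, and its smoothness along the hypersurface follows from them.
\<close>

definition future_unit_normal ::
    "(real ^ 3) set \<Rightarrow> (real ^ 3 \<Rightarrow> real ^ 4) \<Rightarrow> (real ^ 4 \<Rightarrow> real ^ 4) \<Rightarrow> bool" where
  "future_unit_normal U X n \<longleftrightarrow>
     (\<forall>u\<in>U. timelike (n (X u)) \<and> lorentz_norm (n (X u)) = 1 \<and>
             (\<forall>w. lorentz (n (X u)) (frechet_derivative X (at u) w) = 0) \<and>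
             lorentz (n (X u)) (axis 0 1) < 0)"

definition singular_point :: "('a::real_normed_vector \<Rightarrow> 'b::real_normed_vector) \<Rightarrow> 'a \<Rightarrow> bool" where
  "singular_point f p \<longleftrightarrow> \<not> inj (frechet_derivative f (at p))"


section \<open>The frame of a curve in a spacelike hypersurface\<close>

definition tangent :: "(real \<Rightarrow> real ^ 4) \<Rightarrow> real \<Rightarrow> real ^ 4" where
  "tangent \<gamma> s = vector_derivative \<gamma> (at s)"

text \<open>
  In what follows \<open>n\<close> is the normal field and \<open>\<gamma>\<close> the curve, so that the normal field along
  the curve is \<open>\<lambda>s. n (\<gamma> s)\<close>.
\<close>

definition k_n :: "(real ^ 4 \<Rightarrow> real ^ 4) \<Rightarrow> (real \<Rightarrow> real ^ 4) \<Rightarrow> real \<Rightarrow> real" where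
  "k_n n \<gamma> s = - lorentz (n (\<gamma> s)) (vector_derivative (tangent \<gamma>) (at s))"

definition k_g :: "(real ^ 4 \<Rightarrow> real ^ 4) \<Rightarrow> (real \<Rightarrow> real ^ 4) \<Rightarrow> real \<Rightarrow> real" where
  "k_g n \<gamma> s =
     lorentz_norm (vector_derivative (tangent \<gamma>) (at s) - k_n n \<gamma> s *\<^sub>R n (\<gamma> s))"

definition n_1 :: "(real ^ 4 \<Rightarrow> real ^ 4) \<Rightarrow> (real \<Rightarrow> real ^ 4) \<Rightarrow> real \<Rightarrow> real ^ 4" where
  "n_1 n \<gamma> s =
     (vector_derivative (tangent \<gamma>) (at s) - k_n n \<gamma> s *\<^sub>R n (\<gamma> s)) /\<^sub>R k_g n \<gamma> s"

definition n_2 :: "(real ^ 4 \<Rightarrow> real ^ 4) \<Rightarrow> (real \<Rightarrow> real ^ 4) \<Rightarrow> real \<Rightarrow> real ^ 4" where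
  "n_2 n \<gamma> s = wedge (n (\<gamma> s)) (tangent \<gamma> s) (n_1 n \<gamma> s)"

definition \<tau>_1 :: "(real ^ 4 \<Rightarrow> real ^ 4) \<Rightarrow> (real \<Rightarrow> real ^ 4) \<Rightarrow> real \<Rightarrow> real" where
  "\<tau>_1 n \<gamma> s = lorentz (n_1 n \<gamma> s) (vector_derivative (\<lambda>s. n (\<gamma> s)) (at s))"

definition \<tau>_2 :: "(real ^ 4 \<Rightarrow> real ^ 4) \<Rightarrow> (real \<Rightarrow> real ^ 4) \<Rightarrow> real \<Rightarrow> real" where
  "\<tau>_2 n \<gamma> s = lorentz (n_2 n \<gamma> s) (vector_derivative (\<lambda>s. n (\<gamma> s)) (at s))"

definition \<tau>_g :: "(real ^ 4 \<Rightarrow> real ^ 4) \<Rightarrow> (real \<Rightarrow> real ^ 4) \<Rightarrow> real \<Rightarrow> real" where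
  "\<tau>_g n \<gamma> s = - lorentz (vector_derivative (n_2 n \<gamma>) (at s)) (n_1 n \<gamma> s)"


section \<open>The hyperbolic surface and its invariants\<close>

definition hyperbolic_surface ::
    "(real ^ 4 \<Rightarrow> real ^ 4) \<Rightarrow> (real \<Rightarrow> real ^ 4) \<Rightarrow> real \<times> real \<Rightarrow> real ^ 4" where
  "hyperbolic_surface n \<gamma> = (\<lambda>(s, \<theta>).
     (cosh \<theta> / sqrt ((k_g n \<gamma> s)\<^sup>2 - (k_n n \<gamma> s)\<^sup>2)) *\<^sub>R
        (k_g n \<gamma> s *\<^sub>R n (\<gamma> s) + k_n n \<gamma> s *\<^sub>R n_1 n \<gamma> s)
     + sinh \<theta> *\<^sub>R n_2 n \<gamma> s)"

text \<open>The value prescribed for \<open>tanh \<theta>(s)\<close> at the singular points.\<close>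

definition singular_tanh :: "(real ^ 4 \<Rightarrow> real ^ 4) \<Rightarrow> (real \<Rightarrow> real ^ 4) \<Rightarrow> real \<Rightarrow> real" where
  "singular_tanh n \<gamma> s =
     (let kn = k_n n \<gamma> s; kn' = deriv (k_n n \<gamma>) s;
          kg = k_g n \<gamma> s; kg' = deriv (k_g n \<gamma>) s;
          t1 = \<tau>_1 n \<gamma> s; t2 = \<tau>_2 n \<gamma> s; tg = \<tau>_g n \<gamma> s
      in (kg * kn' + kg\<^sup>2 * t1 - kn\<^sup>2 * t1 - kn * kg') /
         ((kn * t2 + kg * tg) * sqrt (kg\<^sup>2 - kn\<^sup>2)))"

definition \<rho> :: "(real ^ 4 \<Rightarrow> real ^ 4) \<Rightarrow> (real \<Rightarrow> real ^ 4) \<Rightarrow> real \<Rightarrow> real" where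
  "\<rho> n \<gamma> s =
     (let kn = k_n n \<gamma> s; kn' = deriv (k_n n \<gamma>) s; kn'' = deriv (deriv (k_n n \<gamma>)) s;
          kg = k_g n \<gamma> s; kg' = deriv (k_g n \<gamma>) s; kg'' = deriv (deriv (k_g n \<gamma>)) s;
          t1 = \<tau>_1 n \<gamma> s; t1' = deriv (\<tau>_1 n \<gamma>) s;
          t2 = \<tau>_2 n \<gamma> s; t2' = deriv (\<tau>_2 n \<gamma>) s;
          tg = \<tau>_g n \<gamma> s; tg' = deriv (\<tau>_g n \<gamma>) s
      in (- kg * kn'' - kg * kn * t2\<^sup>2 - 2 * kg * kg' * t1 - kg\<^sup>2 * t1' - kg\<^sup>2 * tg * t2
          + 2 * kn * kn' * t1 + kn\<^sup>2 * t1' - kn\<^sup>2 * tg * t2 + kg'' * kn - kg * kn * tg\<^sup>2)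
         * (kn * t2 + kg * tg)
         + (kg * kn' + kg\<^sup>2 * t1 - kn\<^sup>2 * t1 - kn * kg')
         * (2 * kn' * t2 + kn * t1 * tg + kn * t2' + 2 * kg' * tg + kg * t1 * t2 + kg * tg'))"

end

theory Submission
  imports Defs
begin

text \<open>
  Write \<open>N, T, N\<^sub>1, N\<^sub>2\<close> for the frame of \<open>\<gamma>\<close>. Since \<open>k\<^sub>g\<^sup>2 > k\<^sub>n\<^sup>2\<close>, the acceleration
  \<open>T' = k\<^sub>n N + k\<^sub>g N\<^sub>1\<close> is spacelike, of length \<open>r = \<surd>(k\<^sub>g\<^sup>2 - k\<^sub>n\<^sup>2)\<close>. Boosting the plane spanned by
  \<open>N\<close> and \<open>N\<^sub>1\<close> so that its spacelike axis \<open>F\<close> points along \<open>T'\<close> and its timelike axis is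
  \<open>E = (k\<^sub>g N + k\<^sub>n N\<^sub>1) / r\<close> gives the simpler equations
  \<open>T' = r F\<close>, \<open>E' = a F + b N\<^sub>2\<close>, \<open>F' = a E + c N\<^sub>2 - r T\<close>, \<open>N\<^sub>2' = b E - c F\<close>.
  The hyperbolic surface is \<open>S = cosh \<theta> E + sinh \<theta> N\<^sub>2\<close>, which runs through one branch of the
  unit timelike vectors orthogonal to both \<open>T\<close> and \<open>T'\<close>, and the prescribed value of \<open>tanh \<theta>\<close> is \<open>a / c\<close>.

  Put \<open>G = sinh \<theta> E + cosh \<theta> N\<^sub>2\<close>. Along \<open>\<theta>(s)\<close> the \<open>F\<close>-component of \<open>S'\<close> is
  \<open>cosh \<theta> a - sinh \<theta> c = 0\<close>, so that \<open>S' = (\<theta>' + b) G\<close>. Differentiating \<open>tanh \<theta> = a / c\<close> and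
  substituting the definitions of \<open>a, b, c\<close> shows that \<open>\<theta>' + b\<close> is \<open>\<rho>\<close> times a function without
  zeros (\<open>angle_deriv\<close>). As \<open>I\<close> is an interval, \<open>S\<close> is constant if and only if \<open>\<rho>\<close> vanishes
  (\<open>constant_iff_rho\<close>).

  If \<open>S\<close> is a constant \<open>v\<close>, then \<open>\<langle>\<gamma>, v\<rangle>' = \<langle>T, S\<rangle> = 0\<close>, so \<open>\<gamma>\<close> lies in a hyperplane with timelike
  normal \<open>v\<close>. Conversely, if \<open>\<langle>\<gamma>, v\<rangle>\<close> is constant, then differentiating three times shows that
  \<open>v\<close> is orthogonal to \<open>T\<close>, to \<open>F\<close> and to \<open>G\<close>, hence proportional to \<open>S\<close>. A fourth derivative
  gives \<open>(\<theta>' + b) \<langle>S, v\<rangle> = 0\<close> with \<open>\<langle>S, v\<rangle> \<noteq> 0\<close>, which forces \<open>\<rho> = 0\<close> (\<open>hyperplane_iff_rho\<close>).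

  These computations need the invariants of \<open>\<gamma>\<close> to be differentiable often enough, whereas the normal
  field is given only by pointwise conditions. Its smoothness comes from the fact that the
  wedge product of the coordinate tangent vectors is a nonvanishing smooth normal field, which only
  has to be rescaled by a smooth factor (\<open>smooth_on_future_unit_normal\<close>).
\<close>

section \<open>Calculus of smooth maps on open sets\<close>

lemma Ck_on_cong:
  assumes "open S" "\<And>x. x \<in> S \<Longrightarrow> f x = g x" "Ck_on k S f"
  shows "Ck_on k S g"
  using assms(2,3)
proof (induction k arbitrary: f g)
  case 0
  then show ?case using continuous_on_cong by (metis Ck_on.simps(1))
next
  case (Suc k)
  have eq: "frechet_derivative f (at x) = frechet_derivative g (at x)" if "x \<in> S" for x
    using frechet_derivative_transform_within_open[of f x S g] Suc.prems \<open>open S\<close> that by auto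
  have "g differentiable (at x)" if "x \<in> S" for x
    using Suc.prems that \<open>open S\<close>
    by (metis Ck_on.simps(2) at_within_open differentiable_transform_within open_contains_ball
        differentiable_def has_derivative_transform_within_open)
  moreover have "Ck_on k S (\<lambda>x. frechet_derivative g (at x) v)" for v
    using Suc.IH[of "\<lambda>x. frechet_derivative f (at x) v" "\<lambda>x. frechet_derivative g (at x) v"] eq Suc.prems
    by simp
  ultimately show ?case by simp
qed

text \<open>
  Class \<open>C\<^sup>k\<^sup>+\<^sup>1\<close> can be checked on any function that is a derivative at the points of \<open>S\<close>. The closure
  properties below rest on it: in the induction on \<open>k\<close>, the derivative is the one given by the rule
  of calculus for the operation in question.
\<close>
lemma Ck_on_SucI:
  assumes "open S" "\<And>x. x \<in> S \<Longrightarrow> (f has_derivative f' x) (at x)"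
    and "\<And>v. Ck_on k S (\<lambda>x. f' x v)"
  shows "Ck_on (Suc k) S f"
proof -
  have "frechet_derivative f (at x) = f' x" if "x \<in> S" for x
    using assms(2)[OF that] frechet_derivative_at by metis
  then have "Ck_on k S (\<lambda>x. frechet_derivative f (at x) v)" for v
    using Ck_on_cong[OF \<open>open S\<close> _ assms(3)[of v]] by simp
  then show ?thesis using assms(2) unfolding Ck_on.simps differentiable_def by blast
qed

lemma Ck_on_SucD:
  assumes "Ck_on (Suc k) S f"
  shows "\<And>x. x \<in> S \<Longrightarrow> (f has_derivative frechet_derivative f (at x)) (at x)"
    and "\<And>v. Ck_on k S (\<lambda>x. frechet_derivative f (at x) v)"
  using assms by (auto simp: frechet_derivative_works)

lemma Ck_on_Suc_imp: "Ck_on (Suc k) S f \<Longrightarrow> Ck_on k S f"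
proof (induction k arbitrary: f)
  case 0
  then show ?case
    by (auto intro!: continuous_at_imp_continuous_on differentiable_imp_continuous_within)
next
  case (Suc k)
  then show ?case unfolding Ck_on.simps(2) by blast
qed

lemma Ck_on_const: "open S \<Longrightarrow> Ck_on k S (\<lambda>x. c)"
proof (induction k arbitrary: c)
  case (Suc k)
  then show ?case by (intro Ck_on_SucI[where f' = "\<lambda>x v. 0"]) (auto intro!: derivative_eq_intros)
qed simp

lemma Ck_on_add:
  "open S \<Longrightarrow> Ck_on k S f \<Longrightarrow> Ck_on k S g \<Longrightarrow> Ck_on k S (\<lambda>x. f x + g x)"
proof (induction k arbitrary: f g)
  case 0 then show ?case by (auto intro: continuous_intros)
next
  case (Suc k)
  show ?case
    by (rule Ck_on_SucI[OF \<open>open S\<close> has_derivative_add[OF Ck_on_SucD(1) Ck_on_SucD(1)]])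
      (use Suc in \<open>auto intro: Ck_on_SucD(2)\<close>)
qed

lemma Ck_on_sum:
  assumes "open S" "\<And>i. i \<in> A \<Longrightarrow> Ck_on k S (f i)"
  shows "Ck_on k S (\<lambda>x. \<Sum>i\<in>A. f i x)"
  using assms(2) by (induction A rule: infinite_finite_induct)
    (auto intro!: Ck_on_const Ck_on_add \<open>open S\<close>)

lemma Ck_on_linear:
  assumes "bounded_linear h"
  shows "open S \<Longrightarrow> Ck_on k S f \<Longrightarrow> Ck_on k S (\<lambda>x. h (f x))"
proof (induction k arbitrary: f)
  case 0 then show ?case by (auto intro: bounded_linear.continuous_on[OF assms])
next
  case (Suc k)
  show ?case
    by (rule Ck_on_SucI[OF \<open>open S\<close> bounded_linear.has_derivative[OF assms Ck_on_SucD(1)]])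
      (use Suc in \<open>auto intro: Ck_on_SucD(2)\<close>)
qed

lemma Ck_on_bilinear:
  assumes "bounded_bilinear p"
  shows "open S \<Longrightarrow> Ck_on k S f \<Longrightarrow> Ck_on k S g \<Longrightarrow> Ck_on k S (\<lambda>x. p (f x) (g x))"
proof (induction k arbitrary: f g)
  case 0 then show ?case by (auto intro: bounded_bilinear.continuous_on[OF assms])
next
  case (Suc k)
  show ?case
    by (rule Ck_on_SucI[OF \<open>open S\<close> bounded_bilinear.FDERIV[OF assms Ck_on_SucD(1) Ck_on_SucD(1)]])
      (use Suc in \<open>auto intro!: Ck_on_add intro: Ck_on_SucD(2) Ck_on_Suc_imp simp del: Ck_on.simps\<close>)
qed

text \<open>
  The derivative of \<open>1/f\<close> contains \<open>1/f\<close> itself, so the induction hypothesis applies to \<open>f\<close> as a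
  function of class \<open>C\<^sup>k\<close>, and then bilinearity of multiplication yields class \<open>C\<^sup>k\<^sup>+\<^sup>1\<close>.
\<close>
lemma Ck_on_inverse:
  fixes f :: "'a::euclidean_space \<Rightarrow> real"
  assumes "open S" "\<And>x. x \<in> S \<Longrightarrow> f x \<noteq> 0"
  shows "Ck_on k S f \<Longrightarrow> Ck_on k S (\<lambda>x. inverse (f x))"
proof (induction k)
  case 0 then show ?case using assms by (auto intro: continuous_intros)
next
  case (Suc k)
  have "Ck_on k S (\<lambda>x. inverse (f x))" using Suc Ck_on_Suc_imp by blast
  then have "Ck_on k S (\<lambda>x. - (inverse (f x) * frechet_derivative f (at x) v * inverse (f x)))" for v
    using Suc.prems \<open>open S\<close>
    by (intro Ck_on_linear[OF bounded_linear_minus[OF bounded_linear_ident]]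
        Ck_on_bilinear[OF bounded_bilinear_mult] Ck_on_SucD(2))
  with Suc.prems assms show ?case
    by (intro Ck_on_SucI[OF _ Deriv.has_derivative_inverse[OF _ Ck_on_SucD(1)]])
qed

lemma Ck_on_sqrt:
  fixes f :: "'a::euclidean_space \<Rightarrow> real"
  assumes "open S" "\<And>x. x \<in> S \<Longrightarrow> f x > 0"
  shows "Ck_on k S f \<Longrightarrow> Ck_on k S (\<lambda>x. sqrt (f x))"
proof (induction k)
  case 0 then show ?case by (auto intro: continuous_intros)
next
  case (Suc k)
  have "Ck_on k S (\<lambda>x. inverse (sqrt (f x)))"
    using assms Suc.IH Ck_on_Suc_imp[OF Suc.prems] by (intro Ck_on_inverse) (auto simp: less_le)
  then have "Ck_on k S (\<lambda>x. frechet_derivative f (at x) v * (inverse 2 * inverse (sqrt (f x))))" for v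
    using Suc.prems \<open>open S\<close>
    by (intro Ck_on_bilinear[OF bounded_bilinear_mult] Ck_on_SucD(2) Ck_on_const)
  moreover have "((\<lambda>x. sqrt (f x)) has_derivative
      (\<lambda>v. frechet_derivative f (at x) v * (inverse 2 * inverse (sqrt (f x))))) (at x)" if "x \<in> S" for x
    using has_derivative_real_sqrt[OF assms(2) Ck_on_SucD(1)[OF Suc.prems], OF that that]
    by (simp add: field_simps)
  ultimately show ?case using \<open>open S\<close> by (intro Ck_on_SucI)
qed

text \<open>
  The chain rule gives \<open>DF(g x) (Dg(x) v)\<close>, in which both the point and the direction depend on \<open>x\<close>.
  Expanding the direction in the standard basis turns this into a sum of products of functions
  \<open>DF(g x) b\<close> with fixed \<open>b\<close>, to which the induction hypothesis applies.
\<close>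
lemma Ck_on_compose:
  fixes g :: "'a::euclidean_space \<Rightarrow> 'b::euclidean_space" and F :: "'b \<Rightarrow> 'c::real_normed_vector"
  assumes "open S" "g ` S \<subseteq> T"
  shows "Ck_on k T F \<Longrightarrow> Ck_on k S g \<Longrightarrow> Ck_on k S (\<lambda>x. F (g x))"
proof (induction k arbitrary: F)
  case 0 then show ?case using assms by (auto intro: continuous_on_compose2)
next
  case (Suc k)
  have "Ck_on k S (\<lambda>x. \<Sum>b\<in>Basis. (frechet_derivative g (at x) v \<bullet> b) *\<^sub>R frechet_derivative F (at (g x)) b)" for v
    using Suc \<open>open S\<close>
    by (intro Ck_on_sum Ck_on_bilinear[OF bounded_bilinear_scaleR]
        Ck_on_linear[OF bounded_linear_inner_left] Suc.IH Ck_on_SucD(2))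
      (auto intro: Ck_on_Suc_imp)
  moreover have "((\<lambda>x. F (g x)) has_derivative
      (\<lambda>v. \<Sum>b\<in>Basis. (frechet_derivative g (at x) v \<bullet> b) *\<^sub>R frechet_derivative F (at (g x)) b)) (at x)"
    if "x \<in> S" for x
  proof -
    have F: "(F has_derivative frechet_derivative F (at (g x))) (at (g x))"
      using Ck_on_SucD(1)[OF Suc.prems(1)] that assms by blast
    have "linear (frechet_derivative F (at (g x)))"
      using F has_derivative_linear by blast
    then have "frechet_derivative F (at (g x)) w =
        (\<Sum>b\<in>Basis. (w \<bullet> b) *\<^sub>R frechet_derivative F (at (g x)) b)" for w
      by (subst euclidean_representation[of w, symmetric])
        (simp only: linear_sum linear_scale)
    then have "(\<lambda>v. frechet_derivative F (at (g x)) (frechet_derivative g (at x) v)) =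
      (\<lambda>v. \<Sum>b\<in>Basis. (frechet_derivative g (at x) v \<bullet> b) *\<^sub>R frechet_derivative F (at (g x)) b)"
      by metis
    then show ?thesis
      using has_derivative_compose[OF Ck_on_SucD(1)[OF Suc.prems(2) that] F] by simp
  qed
  ultimately show ?case using \<open>open S\<close> by (intro Ck_on_SucI)
qed

lemma smooth_on_cong:
  "open S \<Longrightarrow> smooth_on S f \<Longrightarrow> (\<And>x. x \<in> S \<Longrightarrow> f x = g x) \<Longrightarrow> smooth_on S g"
  unfolding smooth_on_def by (blast intro: Ck_on_cong)

lemma smooth_on_const: "open S \<Longrightarrow> smooth_on S (\<lambda>x. c)"
  by (simp add: smooth_on_def Ck_on_const)

lemma smooth_on_add:
  "open S \<Longrightarrow> smooth_on S f \<Longrightarrow> smooth_on S g \<Longrightarrow> smooth_on S (\<lambda>x. f x + g x)"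
  by (simp add: smooth_on_def Ck_on_add)

lemma smooth_on_linear:
  "bounded_linear h \<Longrightarrow> open S \<Longrightarrow> smooth_on S f \<Longrightarrow> smooth_on S (\<lambda>x. h (f x))"
  by (simp add: smooth_on_def Ck_on_linear)

lemma smooth_on_bilinear:
  "bounded_bilinear p \<Longrightarrow> open S \<Longrightarrow> smooth_on S f \<Longrightarrow> smooth_on S g \<Longrightarrow>
    smooth_on S (\<lambda>x. p (f x) (g x))"
  by (simp add: smooth_on_def Ck_on_bilinear)

lemma smooth_on_minus: "open S \<Longrightarrow> smooth_on S f \<Longrightarrow> smooth_on S (\<lambda>x. - f x)"
  by (rule smooth_on_linear[OF bounded_linear_minus[OF bounded_linear_ident]])

lemma smooth_on_diff:
  "open S \<Longrightarrow> smooth_on S f \<Longrightarrow> smooth_on S g \<Longrightarrow> smooth_on S (\<lambda>x. f x - g x)"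
  using smooth_on_add[of S f "\<lambda>x. - g x"] smooth_on_minus by auto

lemmas smooth_on_scaleR = smooth_on_bilinear[OF bounded_bilinear_scaleR]
lemmas smooth_on_mult = smooth_on_bilinear[OF bounded_bilinear_mult]

lemma smooth_on_inverse:
  fixes f :: "'a::euclidean_space \<Rightarrow> real"
  shows "open S \<Longrightarrow> smooth_on S f \<Longrightarrow> (\<And>x. x \<in> S \<Longrightarrow> f x \<noteq> 0) \<Longrightarrow> smooth_on S (\<lambda>x. inverse (f x))"
  by (simp add: smooth_on_def Ck_on_inverse)

lemma smooth_on_sqrt:
  fixes f :: "'a::euclidean_space \<Rightarrow> real"
  shows "open S \<Longrightarrow> smooth_on S f \<Longrightarrow> (\<And>x. x \<in> S \<Longrightarrow> f x > 0) \<Longrightarrow> smooth_on S (\<lambda>x. sqrt (f x))"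
  by (simp add: smooth_on_def Ck_on_sqrt)

lemma smooth_on_compose:
  fixes g :: "'a::euclidean_space \<Rightarrow> 'b::euclidean_space"
  shows "open S \<Longrightarrow> smooth_on S g \<Longrightarrow> smooth_on T F \<Longrightarrow> g ` S \<subseteq> T \<Longrightarrow> smooth_on S (\<lambda>x. F (g x))"
  by (simp add: smooth_on_def Ck_on_compose)

lemma smooth_on_has_derivative:
  "smooth_on S f \<Longrightarrow> x \<in> S \<Longrightarrow> (f has_derivative frechet_derivative f (at x)) (at x)"
  unfolding smooth_on_def using Ck_on_SucD(1) by blast

lemma smooth_on_directional_derivative:
  "smooth_on S f \<Longrightarrow> smooth_on S (\<lambda>x. frechet_derivative f (at x) v)"
  unfolding smooth_on_def using Ck_on_SucD(2) by blast

lemma smooth_on_has_vector_derivative: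
  "smooth_on S f \<Longrightarrow> x \<in> S \<Longrightarrow> (f has_vector_derivative vector_derivative f (at x)) (at x)"
  by (metis differentiableI smooth_on_has_derivative vector_derivative_works)

lemma smooth_on_vector_derivative:
  assumes "open S" "smooth_on S f"
  shows "smooth_on S (\<lambda>x. vector_derivative f (at x))"
proof (rule smooth_on_cong[OF assms(1) smooth_on_directional_derivative[OF assms(2)]])
  show "frechet_derivative f (at x) 1 = vector_derivative f (at x)" if "x \<in> S" for x
    using smooth_on_has_vector_derivative[OF assms(2) that]
      frechet_derivative_at[of f _ x] unfolding has_vector_derivative_def by fastforce
qed

lemma smooth_on_DERIV:
  "smooth_on S f \<Longrightarrow> x \<in> S \<Longrightarrow> (f has_real_derivative deriv f x) (at x)"
  by (metis DERIV_deriv_iff_has_field_derivative differentiableI real_differentiable_def smooth_on_has_derivative)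

lemma smooth_on_deriv:
  fixes f :: "real \<Rightarrow> real"
  assumes "open S" "smooth_on S f"
  shows "smooth_on S (deriv f)"
proof (rule smooth_on_cong[OF assms(1) smooth_on_vector_derivative[OF assms]])
  show "vector_derivative f (at x) = deriv f x" if "x \<in> S" for x
    using smooth_on_DERIV[OF assms(2) that]
    by (simp add: has_real_derivative_iff_has_vector_derivative vector_derivative_at)
qed

section \<open>Minkowski algebra\<close>

lemma det_4:
  "det (A::'a::comm_ring_1^4^4) =
    A$1$1 * (A$2$2 * A$3$3 * A$4$4 + A$2$3 * A$3$4 * A$4$2 + A$2$4 * A$3$2 * A$4$3
           - A$2$4 * A$3$3 * A$4$2 - A$2$3 * A$3$2 * A$4$4 - A$2$2 * A$3$4 * A$4$3)
  - A$1$2 * (A$2$1 * A$3$3 * A$4$4 + A$2$3 * A$3$4 * A$4$1 + A$2$4 * A$3$1 * A$4$3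
           - A$2$4 * A$3$3 * A$4$1 - A$2$3 * A$3$1 * A$4$4 - A$2$1 * A$3$4 * A$4$3)
  + A$1$3 * (A$2$1 * A$3$2 * A$4$4 + A$2$2 * A$3$4 * A$4$1 + A$2$4 * A$3$1 * A$4$2
           - A$2$4 * A$3$2 * A$4$1 - A$2$2 * A$3$1 * A$4$4 - A$2$1 * A$3$4 * A$4$2)
  - A$1$4 * (A$2$1 * A$3$2 * A$4$3 + A$2$2 * A$3$3 * A$4$1 + A$2$3 * A$3$1 * A$4$2
           - A$2$3 * A$3$2 * A$4$1 - A$2$2 * A$3$1 * A$4$3 - A$2$1 * A$3$3 * A$4$2)"
proof -
  have f1234: "finite {2::4, 3, 4}" "1 \<notin> {2::4, 3, 4}"
    by auto
  have f234: "finite {3::4, 4}" "2 \<notin> {3::4, 4}"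
    by auto
  have f34: "finite {4::4}" "3 \<notin> {4::4}"
    by auto
  show ?thesis
    unfolding det_def UNIV_4
    unfolding sum_over_permutations_insert[OF f1234]
    unfolding sum_over_permutations_insert[OF f234]
    unfolding sum_over_permutations_insert[OF f34]
    unfolding permutes_sing
    by (simp add: sign_swap_id permutation_swap_id sign_compose permutation_compose sign_id swap_id_eq algebra_simps)
qed
text \<open>
  The coordinate that Minkowski space calls 0 is index 4 of the library.
\<close>
lemma four_eq_0: "(4::4) = 0" by simp

text \<open>
  The cofactors of the formal determinant. With these formulas the facts on the wedge product become
  polynomial identities in the coordinates.
\<close>
lemma wedge_nth:
  "wedge x y z $ 0 = -(x$1*(y$2*z$3-y$3*z$2) - x$2*(y$1*z$3-y$3*z$1) + x$3*(y$1*z$2-y$2*z$1))"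
  "wedge x y z $ 1 = -(x$0*(y$2*z$3-y$3*z$2) - x$2*(y$0*z$3-y$3*z$0) + x$3*(y$0*z$2-y$2*z$0))"
  "wedge x y z $ 2 = (x$0*(y$1*z$3-y$3*z$1) - x$1*(y$0*z$3-y$3*z$0) + x$3*(y$0*z$1-y$1*z$0))"
  "wedge x y z $ 3 = -(x$0*(y$1*z$2-y$2*z$1) - x$1*(y$0*z$2-y$2*z$0) + x$2*(y$0*z$1-y$1*z$0))"
  unfolding wedge_def by (simp_all add: det_4 axis_def four_eq_0 algebra_simps)

lemma lorentz_wedge:
  "lorentz x (wedge x y z) = 0" "lorentz y (wedge x y z) = 0" "lorentz z (wedge x y z) = 0"
  unfolding lorentz_def wedge_nth by algebra+

text \<open>
  Up to sign, the right-hand side is the Gram determinant of \<open>x, y, z\<close>; the sign is that of the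
  Minkowski metric on \<open>\<real>\<^sup>4\<close>. Three vectors that span a spacelike 3-space therefore
  have a timelike wedge product.
\<close>
lemma lorentz_wedge_wedge:
  "lorentz (wedge x y z) (wedge x y z) =
   - (lorentz x x * (lorentz y y * lorentz z z - lorentz y z * lorentz y z)
    - lorentz x y * (lorentz x y * lorentz z z - lorentz y z * lorentz x z)
    + lorentz x z * (lorentz x y * lorentz y z - lorentz y y * lorentz x z))"
  unfolding lorentz_def wedge_nth by algebra

lemma all_4_zero: "(\<forall>i::4. P i) \<longleftrightarrow> P 0 \<and> P 1 \<and> P 2 \<and> P 3"
  unfolding forall_4 four_eq_0 by blast

text \<open>
  Up to sign and a common factor \<open>det(w, x, y, z)\<close>, the wedge products of three of the vectors
  \<open>w, x, y, z\<close> form the reciprocal basis, and this identity expands \<open>w\<close> in it. It is used for a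
  vector \<open>w\<close> orthogonal to \<open>x\<close>, \<open>y\<close> and \<open>z\<close>, where only the first term remains and shows that \<open>w\<close>
  and \<open>wedge x y z\<close> are proportional.
\<close>
lemma wedge_expansion:
  "lorentz w (wedge x y z) *\<^sub>R w = lorentz w w *\<^sub>R wedge x y z
     - lorentz w x *\<^sub>R wedge w y z - lorentz w y *\<^sub>R wedge x w z - lorentz w z *\<^sub>R wedge x y w"
  unfolding vec_eq_iff all_4_zero
  by (simp add: lorentz_def wedge_nth, intro conjI) algebra+

text \<open>
  For \<open>n\<close> timelike and \<open>\<langle>n, w\<rangle> = 0\<close>, the Cauchy-Schwarz inequality for the spatial parts bounds
  \<open>n\<^sub>0\<^sup>2 w\<^sub>0\<^sup>2\<close> by the product of their squared lengths, and the spatial part of \<open>n\<close> is shorter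
  than \<open>\<bar>n\<^sub>0\<bar>\<close>.
\<close>
lemma timelike_orthogonal_spacelike:
  assumes "timelike n" "lorentz n w = 0" "w \<noteq> 0"
  shows "spacelike w"
proof -
  have n: "(n$1)\<^sup>2 + (n$2)\<^sup>2 + (n$3)\<^sup>2 < (n$0)\<^sup>2" (is "?N < _") and
    w: "n$0 * w$0 = n$1*w$1 + n$2*w$2+n$3*w$3"
    using assms by (auto simp: timelike_def lorentz_def power2_eq_square)
  let ?W = "(w$1)\<^sup>2 + (w$2)\<^sup>2 + (w$3)\<^sup>2"
  have n0: "(n$0)\<^sup>2 > 0" using n by (smt (verit) zero_le_power2)
  \<comment> \<open>Lagrange's identity, whose left-hand side starts with the square of the spatial inner product\<close>
  have "(n$0)\<^sup>2 * (w$0)\<^sup>2 + (n$1*w$2-n$2*w$1)\<^sup>2 + (n$1*w$3-n$3*w$1)\<^sup>2 + (n$2*w$3-n$3*w$2)\<^sup>2 = ?N * ?W"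
    unfolding power_mult_distrib[symmetric] w by algebra
  then have le: "(n$0)\<^sup>2 * (w$0)\<^sup>2 \<le> ?N * ?W"
    by (smt (verit) zero_le_power2)
  have "?W \<noteq> 0"
  proof
    assume "?W = 0"
    then have "w$1 = 0 \<and> w$2 = 0 \<and> w$3 = 0"
      by (smt (verit) zero_le_power2 power_eq_0_iff)
    moreover have "w$0 = 0" using w n0 calculation by simp
    ultimately show False using \<open>w \<noteq> 0\<close> by (simp add: vec_eq_iff all_4_zero)
  qed
  then have "?W > 0" by (smt (verit) zero_le_power2)
  then have "?N * ?W < (n$0)\<^sup>2 * ?W" using n by (rule mult_strict_right_mono[rotated])
  with le have "(n$0)\<^sup>2 * (w$0)\<^sup>2 < (n$0)\<^sup>2 * ?W" by linarith
  then have "(w$0)\<^sup>2 < ?W" unfolding mult_less_cancel_left_pos[OF n0] .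
  then show ?thesis by (simp add: spacelike_def lorentz_def power2_eq_square)
qed

lemma bilinear_lorentz: "bounded_bilinear lorentz"
proof -
  have "bilinear lorentz"
    unfolding bilinear_def lorentz_def
    by (auto intro!: linearI simp: algebra_simps)
  then show ?thesis by (simp add: bilinear_conv_bounded_bilinear)
qed

interpretation lorentz: bounded_bilinear lorentz by (rule bilinear_lorentz)

lemma lorentz_commute: "lorentz x y = lorentz y x"
  by (simp add: lorentz_def mult.commute)

text \<open>
  By the wedge expansion, a vector orthogonal to all four is lightlike or zero; being orthogonal to
  the timelike vector \<open>n\<close>, it cannot be lightlike.
\<close>
lemma pseudo_orthonormal_eq_0I:
  assumes "timelike n"
    and "lorentz (wedge n x y) (wedge n x y) \<noteq> 0"
    and "lorentz n q = 0" "lorentz x q = 0" "lorentz y q = 0" "lorentz (wedge n x y) q = 0"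
  shows "q = 0"
proof (rule ccontr)
  assume "q \<noteq> 0"
  have "lorentz q q *\<^sub>R wedge n x y = 0"
    using wedge_expansion[of q n x y] assms by (simp add: lorentz_commute)
  then have "lorentz q q = 0" using assms(2) by (auto simp: lorentz_def)
  then show False using timelike_orthogonal_spacelike[OF assms(1,3) \<open>q \<noteq> 0\<close>] by (simp add: spacelike_def)
qed

text \<open>
  The Gram determinant of the images of the basis vectors is \<open>-\<langle>W, W\<rangle>\<close>. If it were zero, a vector
  \<open>c \<noteq> 0\<close> in the kernel of the Gram matrix would satisfy \<open>\<langle>L c, L c\<rangle> = 0\<close>, although \<open>L c\<close> is
  spacelike.
\<close>
lemma lorentz_wedge_spacelike_image:
  fixes L :: "real ^ 3 \<Rightarrow> real ^ 4"
  assumes L: "linear L" and sp: "\<And>v. v \<noteq> 0 \<Longrightarrow> spacelike (L v)"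
  defines "W \<equiv> wedge (L (axis 1 1)) (L (axis 2 1)) (L (axis 3 1))"
  shows "lorentz W W \<noteq> 0"
proof
  assume "lorentz W W = 0"
  define G :: "real ^ 3 ^ 3" where "G = (\<chi> i j. lorentz (L (axis i 1)) (L (axis j 1)))"
  have "det G = - lorentz W W"
    unfolding W_def lorentz_wedge_wedge det_3 G_def by (simp add: lorentz_commute algebra_simps)
  then have "\<not> invertible G" using \<open>lorentz W W = 0\<close> by (simp add: invertible_det_nz)
  then obtain c where c: "c \<noteq> 0" "G *v c = 0"
    using matrix_left_invertible_ker[of G] invertible_left_inverse[of G] by blast
  have Lc: "L c = (\<Sum>j\<in>UNIV. c $ j *\<^sub>R L (axis j 1))"
    by (subst basis_expansion[symmetric, of c])
      (simp only: linear_sum[OF L] linear_scale[OF L] scalar_mult_eq_scaleR)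
  have "lorentz (L (axis i 1)) (L c) = (G *v c) $ i" for i
    unfolding Lc by (simp add: lorentz.sum_right lorentz.scaleR_right G_def matrix_vector_mult_def mult.commute)
  then have "lorentz (L (axis i 1)) (L c) = 0" for i using c(2) by simp
  then have "lorentz (L c) (L c) = 0"
    by (subst (1) Lc) (simp add: lorentz.sum_left lorentz.scaleR_left)
  with sp[OF c(1)] show False by (simp add: spacelike_def)
qed

lemma unit_timelike: "timelike v \<Longrightarrow> lorentz_norm v = 1 \<Longrightarrow> lorentz v v = -1"
  unfolding timelike_def lorentz_norm_def by (simp add: abs_if)

lemma unit_spacelike: "spacelike v \<Longrightarrow> lorentz_norm v = 1 \<Longrightarrow> lorentz v v = 1"
  unfolding spacelike_def lorentz_norm_def by (simp add: abs_if)

section \<open>Smoothness and derivatives of Minkowski products\<close>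

lemmas smooth_on_lorentz = smooth_on_bilinear[OF bilinear_lorentz]

lemma smooth_on_vec_nth: "open S \<Longrightarrow> smooth_on S f \<Longrightarrow> smooth_on S (\<lambda>x. f x $ i)"
  by (rule smooth_on_linear[OF bounded_linear_vec_nth])

lemma smooth_on_wedge:
  assumes "open S" "smooth_on S f" "smooth_on S g" "smooth_on S h"
  shows "smooth_on S (\<lambda>x. wedge (f x) (g x) (h x))"
proof -
  have eq: "v = v$0 *\<^sub>R axis 0 1 + v$1 *\<^sub>R axis 1 1 + v$2 *\<^sub>R axis 2 1 + v$3 *\<^sub>R axis 3 1" for v :: "real^4"
    by (simp add: vec_eq_iff all_4_zero axis_def)
  show ?thesis
    by (subst eq, unfold wedge_nth)
      (intro smooth_on_add smooth_on_diff smooth_on_minus smooth_on_scaleR smooth_on_mult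
        smooth_on_const smooth_on_vec_nth assms)
qed

text \<open>
  For two fields of a moving frame this is the antisymmetry of the structure equations.
\<close>
lemma lorentz_constant_deriv:
  assumes "open I" "s \<in> I" "(f has_vector_derivative f') (at s)" "(g has_vector_derivative g') (at s)"
    and "\<And>s. s \<in> I \<Longrightarrow> lorentz (f s) (g s) = k"
  shows "lorentz (f s) g' + lorentz f' (g s) = 0"
proof -
  have "((\<lambda>s. lorentz (f s) (g s)) has_vector_derivative 0) (at s)"
    by (rule has_vector_derivative_transform_within_open[OF has_vector_derivative_const assms(1,2)])
      (simp add: assms(5))
  then show ?thesis
    using vector_derivative_unique_at[OF lorentz.has_vector_derivative[OF assms(3,4)]] by simp
qed

lemma constant_on_interval:
  assumes "is_interval I" and "\<And>s. s \<in> I \<Longrightarrow> (f has_vector_derivative 0) (at s within I)"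
  shows "\<exists>v. \<forall>s\<in>I. f s = v"
  by (rule has_vector_derivative_zero_constant[OF is_interval_convex[OF assms(1)] assms(2)]) auto

section \<open>The unit normal field\<close>

lemma spacelike_embedding_frechet_spacelike:
  assumes "spacelike_embedding_on U X" "u \<in> U" "v \<noteq> 0"
  shows "spacelike (frechet_derivative X (at u) v)"
proof -
  have X: "smooth_on U X" "inj (frechet_derivative X (at u))"
    using assms by (auto simp: spacelike_embedding_on_def smooth_embedding_on_def)
  have "linear (frechet_derivative X (at u))"
    using smooth_on_has_derivative[OF X(1) assms(2)] has_derivative_linear by blast
  then have "frechet_derivative X (at u) v \<noteq> 0"
    using X(2) assms(3) by (metis injD linear_0)
  then show ?thesis using assms by (auto simp: spacelike_embedding_on_def)
qed

text \<open>
  The wedge product \<open>W\<close> of the coordinate tangent vectors is smooth and proportional to the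
  normal: \<open>W = m n\<close> with \<open>m \<noteq> 0\<close>, but \<open>m\<close> is not known to be smooth. Now \<open>\<langle>W, W\<rangle> = -m\<^sup>2\<close>, and
  \<open>p = \<langle>W, e\<^sub>0\<rangle> = m \<langle>n, e\<^sub>0\<rangle>\<close> has the sign of \<open>-m\<close> because \<open>n\<close> is future directed. Hence
  \<open>1/m = -p / \<surd>(-p\<^sup>2 \<langle>W, W\<rangle>)\<close>, which is smooth.
\<close>
lemma smooth_on_future_unit_normal:
  assumes U: "open U" and X: "spacelike_embedding_on U X" and n: "future_unit_normal U X n"
  shows "smooth_on U (\<lambda>u. n (X u))"
proof -
  have sX: "smooth_on U X" using X by (auto simp: spacelike_embedding_on_def smooth_embedding_on_def)
  define D where "D i u = frechet_derivative X (at u) (axis i 1)" for i u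
  define W where "W u = wedge (D 1 u) (D 2 u) (D 3 u)" for u
  define p where "p u = lorentz (W u) (axis 0 1)" for u
  define q where "q u = (p u * p u) * (- lorentz (W u) (W u))" for u
  have D: "smooth_on U (D i)" for i
    unfolding D_def by (rule smooth_on_directional_derivative[OF sX])
  have W: "smooth_on U W" unfolding W_def by (rule smooth_on_wedge[OF U D D D])
  have p: "smooth_on U p" unfolding p_def by (rule smooth_on_lorentz[OF U W smooth_on_const[OF U]])
  have q: "smooth_on U q"
    unfolding q_def by (intro smooth_on_mult smooth_on_minus smooth_on_lorentz U W p)
  have normal: "q u > 0 \<and> (- p u * inverse (sqrt (q u))) *\<^sub>R W u = n (X u)" if u: "u \<in> U" for u
  proof -
    define w where "w = n (X u)"
    define h where "h = lorentz w (axis 0 1)"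
    define m where "m = - lorentz w (W u)"
    have w: "lorentz w w = -1" "\<And>i. lorentz w (D i u) = 0" "h < 0"
      using n u by (auto simp: future_unit_normal_def w_def D_def h_def intro: unit_timelike)
    have Ww: "W u = m *\<^sub>R w"
      using wedge_expansion[of w "D 1 u" "D 2 u" "D 3 u"] w by (simp add: W_def m_def)
    have "lorentz (W u) (W u) \<noteq> 0"
      unfolding W_def D_def
      by (rule lorentz_wedge_spacelike_image)
        (use smooth_on_has_derivative[OF sX u] has_derivative_linear
          spacelike_embedding_frechet_spacelike[OF X u] in blast)+
    then have m: "m \<noteq> 0" unfolding Ww by (auto simp: lorentz.zero_left)
    have pm: "p u = m * h" by (simp add: p_def Ww h_def lorentz.scaleR_left)
    have qm: "q u = (m\<^sup>2 * h)\<^sup>2"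
      unfolding q_def pm Ww by (simp add: lorentz.scaleR_left lorentz.scaleR_right w(1) power2_eq_square)
    have "sqrt (q u) = - (m\<^sup>2 * h)"
      unfolding qm using w(3) by (simp add: abs_mult)
    then have "- p u * inverse (sqrt (q u)) * m = 1"
      using m w(3) by (simp add: pm field_simps power2_eq_square)
    then show ?thesis using m w(3) by (simp add: Ww qm flip: w_def)
  qed
  show ?thesis
    by (rule smooth_on_cong[of U "\<lambda>u. (- p u * inverse (sqrt (q u))) *\<^sub>R W u"])
      (use normal in \<open>fastforce intro!: smooth_on_scaleR smooth_on_mult smooth_on_minus smooth_on_inverse
        smooth_on_sqrt U W p q\<close>)+
qed

section \<open>The hyperbolic surface of an abstract moving frame\<close>

text \<open>
  The frame equations of a curve, detached from the hypersurface. The fields \<open>N, T, N1, N2\<close> stand for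
  the unit normal, the unit tangent and the two remaining fields, and \<open>kn, kg, t1, t2, tg\<close> for
  \<open>k\<^sub>n, k\<^sub>g, \<tau>\<^sub>1, \<tau>\<^sub>2, \<tau>\<^sub>g\<close>.
\<close>
locale lorentz_frame =
  fixes I :: "real set" and N T N1 N2 :: "real \<Rightarrow> real ^ 4" and kn kg t1 t2 tg :: "real \<Rightarrow> real"
  assumes open_I: "open I" and interval_I: "is_interval I"
    and N_deriv: "s \<in> I \<Longrightarrow>
      (N has_vector_derivative kn s *\<^sub>R T s + t1 s *\<^sub>R N1 s + t2 s *\<^sub>R N2 s) (at s)"
    and T_deriv: "s \<in> I \<Longrightarrow> (T has_vector_derivative kn s *\<^sub>R N s + kg s *\<^sub>R N1 s) (at s)"
    and N1_deriv: "s \<in> I \<Longrightarrow>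
      (N1 has_vector_derivative t1 s *\<^sub>R N s - kg s *\<^sub>R T s + tg s *\<^sub>R N2 s) (at s)"
    and N2_deriv: "s \<in> I \<Longrightarrow> (N2 has_vector_derivative t2 s *\<^sub>R N s - tg s *\<^sub>R N1 s) (at s)"
    and orthonormal: "s \<in> I \<Longrightarrow>
      lorentz (N s) (N s) = -1 \<and> lorentz (T s) (T s) = 1 \<and> lorentz (N1 s) (N1 s) = 1 \<and>
      lorentz (N2 s) (N2 s) = 1 \<and> lorentz (N s) (T s) = 0 \<and> lorentz (N s) (N1 s) = 0 \<and>
      lorentz (N s) (N2 s) = 0 \<and> lorentz (T s) (N1 s) = 0 \<and> lorentz (T s) (N2 s) = 0 \<and>
      lorentz (N1 s) (N2 s) = 0"
    and complete: "\<lbrakk>s \<in> I; lorentz (N s) v = 0; lorentz (T s) v = 0; lorentz (N1 s) v = 0;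
      lorentz (N2 s) v = 0\<rbrakk> \<Longrightarrow> v = 0"
    and smooth: "smooth_on I kn" "smooth_on I kg" "smooth_on I t1" "smooth_on I t2" "smooth_on I tg"
    and kg_gt_kn: "s \<in> I \<Longrightarrow> (kn s)\<^sup>2 < (kg s)\<^sup>2"
begin

text \<open>
  The boosted frame \<open>E, F\<close> has \<open>F\<close> along the acceleration \<open>T'\<close>. The functions \<open>A\<close> and \<open>B r\<close> are the
  numerator and the denominator of the prescribed \<open>tanh \<theta>\<close>, which is therefore \<open>a / c\<close>; the
  functions \<open>a, b, c\<close> are the coefficients of the frame \<open>T, E, F, N2\<close>.
\<close>
definition r :: "real \<Rightarrow> real" where "r s = sqrt ((kg s)\<^sup>2 - (kn s)\<^sup>2)"
definition E :: "real \<Rightarrow> real ^ 4" where "E s = (kg s / r s) *\<^sub>R N s + (kn s / r s) *\<^sub>R N1 s"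
definition F :: "real \<Rightarrow> real ^ 4" where "F s = (kn s / r s) *\<^sub>R N s + (kg s / r s) *\<^sub>R N1 s"
definition A :: "real \<Rightarrow> real" where
  "A s = kg s * deriv kn s + (kg s)\<^sup>2 * t1 s - (kn s)\<^sup>2 * t1 s - kn s * deriv kg s"
definition B :: "real \<Rightarrow> real" where "B s = kn s * t2 s + kg s * tg s"
definition a :: "real \<Rightarrow> real" where "a s = A s / (r s)\<^sup>2"
definition b :: "real \<Rightarrow> real" where "b s = (kg s * t2 s + kn s * tg s) / r s"
definition c :: "real \<Rightarrow> real" where "c s = B s / r s"

lemma r_pos: "s \<in> I \<Longrightarrow> r s > 0"
  and r_sq: "s \<in> I \<Longrightarrow> (r s)\<^sup>2 = (kg s)\<^sup>2 - (kn s)\<^sup>2"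
  using kg_gt_kn by (auto simp: r_def less_imp_le)

lemma r_deriv:
  assumes s: "s \<in> I"
  shows "(r has_real_derivative (kg s * deriv kg s - kn s * deriv kn s) / r s) (at s)"
  unfolding r_def
  by (rule derivative_eq_intros smooth_on_DERIV[OF smooth(1) s] smooth_on_DERIV[OF smooth(2) s] refl |
      use kg_gt_kn[OF s] in \<open>simp add: field_simps\<close>)+

text \<open>
  If \<open>kg / r\<close> is positive, then \<open>kg / r\<close> and \<open>kn / r\<close> are \<open>cosh \<phi>\<close> and \<open>sinh \<phi>\<close> for the rapidity
  \<open>\<phi>\<close> of the boost; the lemma then says that \<open>\<phi>' = a - t1\<close>.
\<close>
lemma boost_deriv:
  assumes s: "s \<in> I"
  shows "((\<lambda>s. kg s / r s) has_real_derivative kn s / r s * (a s - t1 s)) (at s)"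
    and "((\<lambda>s. kn s / r s) has_real_derivative kg s / r s * (a s - t1 s)) (at s)"
proof -
  note d = smooth_on_DERIV[OF smooth(1) s] smooth_on_DERIV[OF smooth(2) s] r_deriv[OF s]
  have r: "r s \<noteq> 0" using r_pos[OF s] by simp
  have "(deriv kg s * r s - kg s * ((kg s * deriv kg s - kn s * deriv kn s) / r s)) / (r s * r s)
      = kn s / r s * (a s - t1 s)"
    using r r_sq[OF s] by (simp add: a_def A_def field_simps, algebra)
  then show "((\<lambda>s. kg s / r s) has_real_derivative kn s / r s * (a s - t1 s)) (at s)"
    using DERIV_divide[OF d(2,3) r] by simp
  have "(deriv kn s * r s - kn s * ((kg s * deriv kg s - kn s * deriv kn s) / r s)) / (r s * r s)
      = kg s / r s * (a s - t1 s)"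
    using r r_sq[OF s] by (simp add: a_def A_def field_simps, algebra)
  then show "((\<lambda>s. kn s / r s) has_real_derivative kg s / r s * (a s - t1 s)) (at s)"
    using DERIV_divide[OF d(1,3) r] by simp
qed

lemma E_deriv:
  assumes s: "s \<in> I"
  shows "(E has_vector_derivative a s *\<^sub>R F s + b s *\<^sub>R N2 s) (at s)"
proof -
  have "(E has_vector_derivative
      (kg s / r s) *\<^sub>R (kn s *\<^sub>R T s + t1 s *\<^sub>R N1 s + t2 s *\<^sub>R N2 s)
      + (kn s / r s * (a s - t1 s)) *\<^sub>R N s
      + ((kn s / r s) *\<^sub>R (t1 s *\<^sub>R N s - kg s *\<^sub>R T s + tg s *\<^sub>R N2 s)
      + (kg s / r s * (a s - t1 s)) *\<^sub>R N1 s)) (at s)"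
    unfolding E_def
    by (intro has_vector_derivative_add has_vector_derivative_scaleR boost_deriv N_deriv N1_deriv s)
  also have "(kg s / r s) *\<^sub>R (kn s *\<^sub>R T s + t1 s *\<^sub>R N1 s + t2 s *\<^sub>R N2 s)
      + (kn s / r s * (a s - t1 s)) *\<^sub>R N s
      + ((kn s / r s) *\<^sub>R (t1 s *\<^sub>R N s - kg s *\<^sub>R T s + tg s *\<^sub>R N2 s)
      + (kg s / r s * (a s - t1 s)) *\<^sub>R N1 s) = a s *\<^sub>R F s + b s *\<^sub>R N2 s"
    using r_pos[OF s] unfolding F_def b_def vec_eq_iff by (simp add: field_simps)
  finally show ?thesis .
qed

lemma F_deriv:
  assumes s: "s \<in> I"
  shows "(F has_vector_derivative a s *\<^sub>R E s + c s *\<^sub>R N2 s - r s *\<^sub>R T s) (at s)"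
proof -
  have "(F has_vector_derivative
      (kn s / r s) *\<^sub>R (kn s *\<^sub>R T s + t1 s *\<^sub>R N1 s + t2 s *\<^sub>R N2 s)
      + (kg s / r s * (a s - t1 s)) *\<^sub>R N s
      + ((kg s / r s) *\<^sub>R (t1 s *\<^sub>R N s - kg s *\<^sub>R T s + tg s *\<^sub>R N2 s)
      + (kn s / r s * (a s - t1 s)) *\<^sub>R N1 s)) (at s)"
    unfolding F_def
    by (intro has_vector_derivative_add has_vector_derivative_scaleR boost_deriv N_deriv N1_deriv s)
  also have "(kn s / r s) *\<^sub>R (kn s *\<^sub>R T s + t1 s *\<^sub>R N1 s + t2 s *\<^sub>R N2 s)
      + (kg s / r s * (a s - t1 s)) *\<^sub>R N s
      + ((kg s / r s) *\<^sub>R (t1 s *\<^sub>R N s - kg s *\<^sub>R T s + tg s *\<^sub>R N2 s)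
      + (kn s / r s * (a s - t1 s)) *\<^sub>R N1 s)
      = a s *\<^sub>R E s + c s *\<^sub>R N2 s - (((kg s)\<^sup>2 - (kn s)\<^sup>2) / r s) *\<^sub>R T s"
    using r_pos[OF s] unfolding E_def c_def B_def vec_eq_iff by (simp add: field_simps power2_eq_square)
  also have "((kg s)\<^sup>2 - (kn s)\<^sup>2) / r s = r s"
    using r_sq[OF s] r_pos[OF s] by (simp add: field_simps power2_eq_square)
  finally show ?thesis .
qed

lemma T_deriv': "s \<in> I \<Longrightarrow> (T has_vector_derivative r s *\<^sub>R F s) (at s)"
  using T_deriv r_pos by (fastforce simp: F_def scaleR_add_right)

lemma N2_deriv':
  assumes s: "s \<in> I"
  shows "(N2 has_vector_derivative b s *\<^sub>R E s - c s *\<^sub>R F s) (at s)"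
proof -
  have r: "r s \<noteq> 0" using r_pos[OF s] by simp
  have "b s * (kg s / r s) - c s * (kn s / r s) = t2 s" "c s * (kg s / r s) - b s * (kn s / r s) = tg s"
    using r r_sq[OF s] by (simp_all add: b_def c_def B_def field_simps) algebra+
  moreover have "b s *\<^sub>R E s - c s *\<^sub>R F s
      = (b s * (kg s / r s) - c s * (kn s / r s)) *\<^sub>R N s - (c s * (kg s / r s) - b s * (kn s / r s)) *\<^sub>R N1 s"
    unfolding E_def F_def by (simp add: algebra_simps)
  ultimately have "b s *\<^sub>R E s - c s *\<^sub>R F s = t2 s *\<^sub>R N s - tg s *\<^sub>R N1 s" by simp
  then show ?thesis using N2_deriv[OF s] by simp
qed

text \<open>
  The invariant \<open>\<rho>\<close>, with two of its subterms folded into \<open>A\<close> and \<open>B\<close>.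
\<close>
definition rho :: "real \<Rightarrow> real" where
  "rho s = (- kg s * deriv (deriv kn) s - kg s * kn s * (t2 s)\<^sup>2 - 2 * kg s * deriv kg s * t1 s
      - (kg s)\<^sup>2 * deriv t1 s - (kg s)\<^sup>2 * tg s * t2 s + 2 * kn s * deriv kn s * t1 s
      + (kn s)\<^sup>2 * deriv t1 s - (kn s)\<^sup>2 * tg s * t2 s + deriv (deriv kg) s * kn s
      - kg s * kn s * (tg s)\<^sup>2) * B s
    + A s * (2 * deriv kn s * t2 s + kn s * t1 s * tg s + kn s * deriv t2 s + 2 * deriv kg s * tg s
      + kg s * t1 s * t2 s + kg s * deriv tg s)"

end

text \<open>
  Such a function \<open>\<theta>\<close> is differentiable, because the inverse hyperbolic tangent is smooth on
  \<open>(-1, 1)\<close>.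
\<close>
locale lorentz_frame_angle = lorentz_frame +
  fixes \<theta> :: "real \<Rightarrow> real"
  assumes B_nz: "s \<in> I \<Longrightarrow> B s \<noteq> 0"
    and tanh_angle: "s \<in> I \<Longrightarrow> tanh (\<theta> s) = A s / (B s * r s)"
begin

text \<open>
  This turns out to be \<open>\<theta>' + b\<close>, the factor by which \<open>S'\<close> is a multiple of \<open>G\<close>.
\<close>
definition \<omega> where "\<omega> s = - rho s * r s / ((B s * r s)\<^sup>2 - (A s)\<^sup>2)"

lemma A_less: "s \<in> I \<Longrightarrow> (A s)\<^sup>2 < (B s * r s)\<^sup>2"
proof -
  assume s: "s \<in> I"
  have "\<bar>A s / (B s * r s)\<bar> < 1"
    using tanh_angle[OF s] tanh_real_lt_1[of "\<theta> s"] tanh_real_gt_neg1[of "\<theta> s"] by auto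
  then show ?thesis using B_nz[OF s] r_pos[OF s]
    by (simp add: abs_divide abs_le_square_iff flip: not_le)
qed

text \<open>
  From \<open>tanh \<theta> = a / c\<close> one gets \<open>\<theta>' = (a' c - a c') / (c\<^sup>2 - a\<^sup>2)\<close>. That
  \<open>a' c - a c' + b (c\<^sup>2 - a\<^sup>2)\<close> is \<open>-\<rho> / r\<^sup>3\<close> is the identity behind the definition of
  \<open>\<rho>\<close>. It is verified for \<open>A\<close> and \<open>B r\<close> in place of \<open>a\<close> and \<open>c\<close>, where it becomes a polynomial
  identity, since after a multiplication by \<open>r\<close> only even powers of the square root \<open>r\<close> occur.
\<close>
lemma angle_deriv:
  assumes s: "s \<in> I"
  shows "(\<theta> has_real_derivative \<omega> s - b s) (at s)"
proof -
  define dA where "dA = kg s * deriv (deriv kn) s + deriv kg s * deriv kn s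
    + 2 * kg s * deriv kg s * t1 s + (kg s)\<^sup>2 * deriv t1 s - 2 * kn s * deriv kn s * t1 s
    - (kn s)\<^sup>2 * deriv t1 s - deriv kn s * deriv kg s - kn s * deriv (deriv kg) s"
  define dB where "dB = deriv kn s * t2 s + kn s * deriv t2 s + deriv kg s * tg s + kg s * deriv tg s"
  define dr where "dr = (kg s * deriv kg s - kn s * deriv kn s) / r s"
  note sm = smooth smooth(1,2)[THEN smooth_on_deriv[OF open_I]]
  have dA: "(A has_real_derivative dA) (at s)"
    unfolding A_def
    by (rule derivative_eq_intros sm[THEN smooth_on_DERIV[OF _ s]] refl)+
      (simp add: dA_def algebra_simps)
  have dB: "(B has_real_derivative dB) (at s)"
    unfolding B_def
    by (rule derivative_eq_intros sm[THEN smooth_on_DERIV[OF _ s]] refl)+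
      (simp add: dB_def algebra_simps)
  have nz: "B s * r s \<noteq> 0" using B_nz[OF s] r_pos[OF s] by simp
  have "((\<lambda>s. A s / (B s * r s)) has_real_derivative
      (dA * (B s * r s) - A s * (dB * r s + B s * dr)) / (B s * r s)\<^sup>2) (at s)"
    using DERIV_divide[OF dA DERIV_mult[OF dB r_deriv[OF s]] nz]
    by (simp add: dr_def power2_eq_square algebra_simps)
  moreover have lt: "\<bar>A s / (B s * r s)\<bar> < 1"
    using tanh_angle[OF s] tanh_real_lt_1[of "\<theta> s"] tanh_real_gt_neg1[of "\<theta> s"] by auto
  ultimately have "((\<lambda>s. artanh (A s / (B s * r s))) has_real_derivative
      1 / (1 - (A s / (B s * r s))\<^sup>2) * ((dA * (B s * r s) - A s * (dB * r s + B s * dr)) / (B s * r s)\<^sup>2)) (at s)"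
    by (intro DERIV_chain2[OF artanh_real_has_field_derivative])
  also have "1 / (1 - (A s / (B s * r s))\<^sup>2) * ((dA * (B s * r s) - A s * (dB * r s + B s * dr)) / (B s * r s)\<^sup>2)
     = (dA * (B s * r s) - A s * (dB * r s + B s * dr)) / ((B s * r s)\<^sup>2 - (A s)\<^sup>2)"
    using nz by (simp add: power_divide divide_simps)
  also have "dA * (B s * r s) - A s * (dB * r s + B s * dr)
     = - rho s * r s - b s * ((B s * r s)\<^sup>2 - (A s)\<^sup>2)"
  proof -
    have "dA * B s * ((kg s)\<^sup>2 - (kn s)\<^sup>2) - A s * dB * ((kg s)\<^sup>2 - (kn s)\<^sup>2) - A s * B s * (kg s * deriv kg s - kn s * deriv kn s)
       = - rho s * ((kg s)\<^sup>2 - (kn s)\<^sup>2)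
         - (kg s * t2 s + kn s * tg s) * ((B s)\<^sup>2 * ((kg s)\<^sup>2 - (kn s)\<^sup>2) - (A s)\<^sup>2)"
      unfolding dA_def dB_def rho_def A_def B_def by algebra
    then show ?thesis using r_pos[OF s] unfolding r_sq[OF s, symmetric]
      by (simp add: dr_def b_def field_simps power2_eq_square)
  qed
  also have "(- rho s * r s - b s * ((B s * r s)\<^sup>2 - (A s)\<^sup>2)) / ((B s * r s)\<^sup>2 - (A s)\<^sup>2) = \<omega> s - b s"
    using A_less[OF s] by (simp add: \<omega>_def diff_divide_distrib)
  finally show ?thesis
    by (rule has_field_derivative_transform_within_open[OF _ open_I s])
      (metis tanh_angle artanh_tanh_real)
qed

definition S where "S s = cosh (\<theta> s) *\<^sub>R E s + sinh (\<theta> s) *\<^sub>R N2 s"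

lemma angle_eq: "s \<in> I \<Longrightarrow> cosh (\<theta> s) * a s = sinh (\<theta> s) * c s"
  using tanh_angle[of s] r_pos[of s] B_nz[of s] cosh_real_pos[of "\<theta> s"]
  by (simp add: tanh_def a_def c_def field_simps power2_eq_square)

text \<open>
  The unit spacelike vector that completes \<open>T, F, S\<close> to a pseudo-orthonormal frame.
\<close>
definition G where "G s = sinh (\<theta> s) *\<^sub>R E s + cosh (\<theta> s) *\<^sub>R N2 s"

text \<open>
  The choice of the angle cancels the \<open>F\<close>-component.
\<close>
lemma S_deriv:
  assumes s: "s \<in> I"
  shows "(S has_vector_derivative \<omega> s *\<^sub>R G s) (at s)"
proof -
  have "(S has_vector_derivative
      cosh (\<theta> s) *\<^sub>R (a s *\<^sub>R F s + b s *\<^sub>R N2 s) + (sinh (\<theta> s) * (\<omega> s - b s)) *\<^sub>R E s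
      + (sinh (\<theta> s) *\<^sub>R (b s *\<^sub>R E s - c s *\<^sub>R F s) + (cosh (\<theta> s) * (\<omega> s - b s)) *\<^sub>R N2 s)) (at s)"
    unfolding S_def
    by (intro has_vector_derivative_add has_vector_derivative_scaleR E_deriv N2_deriv' s
        has_field_derivative_cosh has_field_derivative_sinh angle_deriv)
  also have "cosh (\<theta> s) *\<^sub>R (a s *\<^sub>R F s + b s *\<^sub>R N2 s) + (sinh (\<theta> s) * (\<omega> s - b s)) *\<^sub>R E s
      + (sinh (\<theta> s) *\<^sub>R (b s *\<^sub>R E s - c s *\<^sub>R F s) + (cosh (\<theta> s) * (\<omega> s - b s)) *\<^sub>R N2 s)
    = (cosh (\<theta> s) * a s - sinh (\<theta> s) * c s) *\<^sub>R F s + \<omega> s *\<^sub>R G s"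
    by (simp add: G_def algebra_simps)
  finally show ?thesis using angle_eq[OF s] by simp
qed

lemma G_deriv:
  assumes s: "s \<in> I"
  shows "(G has_vector_derivative \<omega> s *\<^sub>R S s + (sinh (\<theta> s) * a s - cosh (\<theta> s) * c s) *\<^sub>R F s) (at s)"
proof -
  have "(G has_vector_derivative
      sinh (\<theta> s) *\<^sub>R (a s *\<^sub>R F s + b s *\<^sub>R N2 s) + (cosh (\<theta> s) * (\<omega> s - b s)) *\<^sub>R E s
      + (cosh (\<theta> s) *\<^sub>R (b s *\<^sub>R E s - c s *\<^sub>R F s) + (sinh (\<theta> s) * (\<omega> s - b s)) *\<^sub>R N2 s)) (at s)"
    unfolding G_def
    by (intro has_vector_derivative_add has_vector_derivative_scaleR E_deriv N2_deriv' s
        has_field_derivative_cosh has_field_derivative_sinh angle_deriv)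
  also have "sinh (\<theta> s) *\<^sub>R (a s *\<^sub>R F s + b s *\<^sub>R N2 s) + (cosh (\<theta> s) * (\<omega> s - b s)) *\<^sub>R E s
      + (cosh (\<theta> s) *\<^sub>R (b s *\<^sub>R E s - c s *\<^sub>R F s) + (sinh (\<theta> s) * (\<omega> s - b s)) *\<^sub>R N2 s)
    = \<omega> s *\<^sub>R S s + (sinh (\<theta> s) * a s - cosh (\<theta> s) * c s) *\<^sub>R F s"
    by (simp add: S_def algebra_simps)
  finally show ?thesis .
qed

lemma \<omega>_eq_0_iff: "s \<in> I \<Longrightarrow> \<omega> s = 0 \<longleftrightarrow> rho s = 0"
  using A_less[of s] r_pos[of s] by (simp add: \<omega>_def)

lemma lorentz_E_E: "s \<in> I \<Longrightarrow> lorentz (E s) (E s) = -1"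
proof -
  assume s: "s \<in> I"
  have "lorentz (E s) (E s) = ((kn s)\<^sup>2 - (kg s)\<^sup>2) / (r s)\<^sup>2"
    using orthonormal[OF s]
    by (simp add: E_def lorentz.add_left lorentz.add_right lorentz.scaleR_left lorentz.scaleR_right
        lorentz_commute[of "N1 s" "N s"] diff_divide_distrib power2_eq_square)
  also have "(kn s)\<^sup>2 - (kg s)\<^sup>2 = - (r s)\<^sup>2" using r_sq[OF s] by simp
  finally show ?thesis using r_pos[OF s] by simp
qed

lemma lorentz_E_N2: "s \<in> I \<Longrightarrow> lorentz (E s) (N2 s) = 0"
  using orthonormal[of s] by (simp add: E_def lorentz.add_left lorentz.scaleR_left)

lemma lorentz_T_S: "s \<in> I \<Longrightarrow> lorentz (T s) (S s) = 0"
  using orthonormal[of s]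
  by (simp add: S_def E_def lorentz.add_right lorentz.scaleR_right lorentz_commute[of "T s" "N s"])

lemma lorentz_S_S: "s \<in> I \<Longrightarrow> lorentz (S s) (S s) = -1"
  using orthonormal[of s] lorentz_E_E[of s] lorentz_E_N2[of s] cosh_square_eq[of "\<theta> s"]
  by (simp add: S_def lorentz.add_left lorentz.add_right lorentz.scaleR_left lorentz.scaleR_right
        lorentz_commute[of "N2 s" "E s"] power2_eq_square)

lemma lorentz_G_G: "s \<in> I \<Longrightarrow> lorentz (G s) (G s) = 1"
  using orthonormal[of s] lorentz_E_E[of s] lorentz_E_N2[of s] cosh_square_eq[of "\<theta> s"]
  by (simp add: G_def lorentz.add_left lorentz.add_right lorentz.scaleR_left lorentz.scaleR_right
        lorentz_commute[of "N2 s" "E s"] power2_eq_square)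

text \<open>
  Both \<open>S, G\<close> and \<open>E, F\<close> arise by an invertible hyperbolic rotation, from \<open>E, N2\<close> and from
  \<open>N, N1\<close> respectively, so orthogonality to the former passes to the latter.
\<close>
lemma boosted_frame_complete:
  assumes s: "s \<in> I" and "lorentz (T s) v = 0" "lorentz (F s) v = 0" "lorentz (S s) v = 0" "lorentz (G s) v = 0"
  shows "v = 0"
proof -
  have boost: "x = 0 \<and> y = 0" if "p * x + q * y = 0" "q * x + p * y = 0" "p\<^sup>2 \<noteq> q\<^sup>2" for p q x y :: real
  proof -
    have "(p\<^sup>2 - q\<^sup>2) * x = 0" "(p\<^sup>2 - q\<^sup>2) * y = 0" using that(1,2) by algebra+
    then show ?thesis using that(3) by simp
  qed
  have "lorentz (E s) v = 0 \<and> lorentz (N2 s) v = 0"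
    using assms(4,5) cosh_square_eq[of "\<theta> s"]
    by (intro boost[of "cosh (\<theta> s)" _ "sinh (\<theta> s)"])
      (simp_all add: S_def G_def lorentz.add_left lorentz.scaleR_left)
  moreover have "lorentz (N s) v = 0 \<and> lorentz (N1 s) v = 0" if "lorentz (E s) v = 0"
    using assms(3) that kg_gt_kn[OF s] r_pos[OF s]
    by (intro boost[of "kg s / r s" _ "kn s / r s"])
      (simp_all add: E_def F_def lorentz.add_left lorentz.scaleR_left power_divide)
  ultimately show ?thesis using complete[OF s _ assms(2)] by blast
qed

text \<open>
  \<open>S' = \<omega> G\<close> with \<open>G \<noteq> 0\<close>, and \<open>\<omega>\<close> has the zeros of \<open>\<rho>\<close>.
\<close>
lemma constant_iff_rho: "(\<exists>v. \<forall>s\<in>I. S s = v) \<longleftrightarrow> (\<forall>s\<in>I. rho s = 0)"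
proof
  assume "\<exists>v. \<forall>s\<in>I. S s = v"
  then obtain v where v: "\<And>s. s \<in> I \<Longrightarrow> S s = v" by blast
  show "\<forall>s\<in>I. rho s = 0"
  proof
    fix s assume s: "s \<in> I"
    have "(S has_vector_derivative 0) (at s)"
      by (rule has_vector_derivative_transform_within_open[OF has_vector_derivative_const open_I s])
        (simp add: v)
    then have "\<omega> s *\<^sub>R G s = 0" using S_deriv[OF s] vector_derivative_unique_at by blast
    moreover have "G s \<noteq> 0" using lorentz_G_G[OF s] by (auto simp: lorentz.zero_left)
    ultimately show "rho s = 0" using \<omega>_eq_0_iff[OF s] by simp
  qed
next
  assume "\<forall>s\<in>I. rho s = 0"
  then have "(S has_vector_derivative 0) (at s within I)" if "s \<in> I" for s
    using S_deriv[OF that] \<omega>_eq_0_iff[OF that] that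
    by (simp add: has_vector_derivative_at_within)
  then show "\<exists>v. \<forall>s\<in>I. S s = v"
    by (rule constant_on_interval[OF interval_I])
qed

text \<open>
  Given a hyperplane with normal \<open>v\<close>, successive differentiation of \<open>\<langle>\<gamma>, v\<rangle>\<close> yields
  \<open>v\<close> orthogonal to \<open>T\<close>, then \<open>F\<close>, then \<open>a E + c N2\<close>, which is proportional to \<open>G\<close> by the choice of
  the angle. Hence \<open>v\<close> is a nonzero multiple of \<open>S\<close>, and the \<open>S\<close>-component \<open>\<omega>\<close> of \<open>G'\<close>
  must vanish. For the converse, the constant value of \<open>S\<close> serves as \<open>v\<close>.
\<close>
lemma hyperplane_iff_rho:
  assumes "I \<noteq> {}" and \<gamma>: "\<And>s. s \<in> I \<Longrightarrow> (\<gamma> has_vector_derivative T s) (at s)"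
  shows "(\<exists>v k. timelike v \<and> \<gamma> ` I \<subseteq> HP v k) \<longleftrightarrow> (\<forall>s\<in>I. rho s = 0)"
proof
  assume "\<exists>v k. timelike v \<and> \<gamma> ` I \<subseteq> HP v k"
  then obtain v k where v: "timelike v" and "\<gamma> ` I \<subseteq> HP v k" by blast
  then have k: "\<And>s. s \<in> I \<Longrightarrow> lorentz (\<gamma> s) v = k" by (auto simp: HP_def)
  have T: "lorentz (T s) v = 0" if "s \<in> I" for s
    using lorentz_constant_deriv[OF open_I that \<gamma>[OF that] has_vector_derivative_const k]
    by (simp add: lorentz.zero_right)
  have F: "lorentz (F s) v = 0" if "s \<in> I" for s
    using lorentz_constant_deriv[OF open_I that T_deriv'[OF that] has_vector_derivative_const T]
      r_pos[OF that] by (simp add: lorentz.zero_right lorentz.scaleR_left)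
  have G: "lorentz (G s) v = 0" if s: "s \<in> I" for s
  proof -
    have "a s * lorentz (E s) v + c s * lorentz (N2 s) v = 0"
      using lorentz_constant_deriv[OF open_I s F_deriv[OF s] has_vector_derivative_const F] T[OF s]
      by (simp add: lorentz.zero_right lorentz.scaleR_left lorentz.add_left lorentz.diff_left)
    then have "c s * lorentz (G s) v = 0"
      using angle_eq[OF s] unfolding G_def lorentz.add_left lorentz.scaleR_left real_scaleR_def by algebra
    then show ?thesis using B_nz[OF s] r_pos[OF s] by (simp add: c_def)
  qed
  show "\<forall>s\<in>I. rho s = 0"
  proof
    fix s assume s: "s \<in> I"
    have "\<omega> s * lorentz (S s) v = 0"
      using lorentz_constant_deriv[OF open_I s G_deriv[OF s] has_vector_derivative_const G] F[OF s]
      by (simp add: lorentz.zero_right lorentz.scaleR_left lorentz.add_left)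
    moreover have "lorentz (S s) v \<noteq> 0"
      using boosted_frame_complete[OF s T[OF s] F[OF s] _ G[OF s]] v by (auto simp: timelike_def lorentz.zero_right)
    ultimately show "rho s = 0" using \<omega>_eq_0_iff[OF s] by simp
  qed
next
  assume "\<forall>s\<in>I. rho s = 0"
  then obtain v where v: "\<And>s. s \<in> I \<Longrightarrow> S s = v" using constant_iff_rho by blast
  obtain s0 where s0: "s0 \<in> I" using \<open>I \<noteq> {}\<close> by blast
  have "((\<lambda>s. lorentz (\<gamma> s) v) has_vector_derivative 0) (at s within I)" if "s \<in> I" for s
    using lorentz.has_vector_derivative[OF \<gamma>[OF that] has_vector_derivative_const, of v]
      lorentz_T_S[OF that] v[OF that]
    by (simp add: lorentz.zero_right has_vector_derivative_at_within)
  then obtain k where "\<forall>s\<in>I. lorentz (\<gamma> s) v = k"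
    using constant_on_interval[OF interval_I, of "\<lambda>s. lorentz (\<gamma> s) v"] by blast
  moreover have "timelike v" using lorentz_S_S[OF s0] v[OF s0] by (simp add: timelike_def)
  ultimately show "\<exists>v k. timelike v \<and> \<gamma> ` I \<subseteq> HP v k" by (auto simp: HP_def)
qed

end

section \<open>Frenet-type equations of a curve in a spacelike hypersurface\<close>

text \<open>
  What the frame equations need from the hypersurface: a smooth unit timelike field along the
  curve that is orthogonal to its tangent.
\<close>
locale unit_speed_curve =
  fixes I :: "real set" and n :: "real ^ 4 \<Rightarrow> real ^ 4" and \<gamma> :: "real \<Rightarrow> real ^ 4"
  assumes open_I: "open I" and interval_I: "is_interval I"
    and smooth_curve: "smooth_on I \<gamma>" and smooth_normal: "smooth_on I (\<lambda>s. n (\<gamma> s))"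
    and normal_unit: "s \<in> I \<Longrightarrow> lorentz (n (\<gamma> s)) (n (\<gamma> s)) = -1"
    and normal_tangent: "s \<in> I \<Longrightarrow> lorentz (n (\<gamma> s)) (tangent \<gamma> s) = 0"
    and tangent_unit: "s \<in> I \<Longrightarrow> lorentz (tangent \<gamma> s) (tangent \<gamma> s) = 1"
    and k_g_nonzero: "s \<in> I \<Longrightarrow> k_g n \<gamma> s \<noteq> 0"
begin

abbreviation "N \<equiv> \<lambda>s. n (\<gamma> s)"
abbreviation "T \<equiv> tangent \<gamma>"
abbreviation "N1 \<equiv> n_1 n \<gamma>"
abbreviation "N2 \<equiv> n_2 n \<gamma>"
abbreviation "T' \<equiv> \<lambda>s. vector_derivative T (at s)"

lemma curve_deriv: "s \<in> I \<Longrightarrow> (\<gamma> has_vector_derivative T s) (at s)"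
  unfolding tangent_def by (rule smooth_on_has_vector_derivative[OF smooth_curve])

lemma smooth_tangent: "smooth_on I T"
  using smooth_on_vector_derivative[OF open_I smooth_curve] by (simp add: tangent_def[abs_def])

lemma smooth_T': "smooth_on I T'"
  by (rule smooth_on_vector_derivative[OF open_I smooth_tangent])

lemma smooth_k_n: "smooth_on I (k_n n \<gamma>)"
  using smooth_on_minus[OF open_I smooth_on_lorentz[OF open_I smooth_normal smooth_T']]
  by (simp add: k_n_def[abs_def])

text \<open>
  The component of the acceleration tangent to the hypersurface, so that \<open>k\<^sub>g\<close> is its length and
  \<open>n\<^sub>1\<close> its direction.
\<close>
definition V where "V s = T' s - k_n n \<gamma> s *\<^sub>R N s"

lemma smooth_V: "smooth_on I V"
  unfolding V_def
  by (intro smooth_on_diff smooth_on_scaleR open_I smooth_T' smooth_k_n smooth_normal)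

lemma k_g_V: "k_g n \<gamma> s = lorentz_norm (V s)"
  by (simp add: k_g_def V_def)

lemma N1_V: "N1 s = V s /\<^sub>R k_g n \<gamma> s"
  by (simp add: n_1_def V_def)

lemma lorentz_N_V: "s \<in> I \<Longrightarrow> lorentz (N s) (V s) = 0"
  by (simp add: V_def k_n_def lorentz.add_right lorentz.scaleR_right normal_unit)

lemma spacelike_V:
  assumes s: "s \<in> I" shows "spacelike (V s)"
proof (rule timelike_orthogonal_spacelike[OF _ lorentz_N_V[OF s]])
  show "timelike (N s)" by (simp add: timelike_def normal_unit s)
  show "V s \<noteq> 0" using k_g_nonzero[OF s] by (auto simp: k_g_V lorentz_norm_def lorentz.zero_left)
qed

text \<open>
  As \<open>V\<close> is spacelike, the absolute value in the norm can be dropped, which makes \<open>k\<^sub>g\<close> smooth.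
\<close>
lemma k_g_sqrt: "s \<in> I \<Longrightarrow> k_g n \<gamma> s = sqrt (lorentz (V s) (V s))"
  using spacelike_V[of s] by (simp add: k_g_V lorentz_norm_def spacelike_def)

lemma smooth_k_g: "smooth_on I (k_g n \<gamma>)"
  by (rule smooth_on_cong[OF open_I smooth_on_sqrt[OF open_I smooth_on_lorentz[OF open_I smooth_V smooth_V]]])
    (use spacelike_V k_g_sqrt in \<open>auto simp: spacelike_def\<close>)

lemma smooth_N1: "smooth_on I N1"
  unfolding N1_V
  by (intro smooth_on_scaleR smooth_on_inverse open_I smooth_k_g smooth_V k_g_nonzero)

lemma smooth_N2: "smooth_on I N2"
  unfolding n_2_def
  by (rule smooth_on_wedge[OF open_I smooth_normal smooth_tangent smooth_N1])

lemma smooth_torsions: "smooth_on I (\<tau>_1 n \<gamma>)" "smooth_on I (\<tau>_2 n \<gamma>)" "smooth_on I (\<tau>_g n \<gamma>)"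
  unfolding \<tau>_1_def \<tau>_2_def \<tau>_g_def
  by (intro smooth_on_minus smooth_on_lorentz smooth_on_vector_derivative smooth_N1 smooth_N2
      smooth_normal open_I)+

lemma derivs:
  assumes "s \<in> I"
  shows "(N has_vector_derivative vector_derivative N (at s)) (at s)"
    and "(T has_vector_derivative T' s) (at s)"
    and "(N1 has_vector_derivative vector_derivative N1 (at s)) (at s)"
    and "(N2 has_vector_derivative vector_derivative N2 (at s)) (at s)"
  using smooth_on_has_vector_derivative[OF _ assms] smooth_normal smooth_tangent smooth_N1 smooth_N2
  by blast+

lemma lorentz_T_T': "s \<in> I \<Longrightarrow> lorentz (T s) (T' s) = 0"
  using lorentz_constant_deriv[OF open_I _ derivs(2) derivs(2) tangent_unit, of s]
  by (simp add: lorentz_commute[of "T' s" "T s"])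

lemma orthonormal:
  assumes s: "s \<in> I"
  shows "lorentz (N s) (N s) = -1" "lorentz (T s) (T s) = 1" "lorentz (N1 s) (N1 s) = 1"
    "lorentz (N2 s) (N2 s) = 1" "lorentz (N s) (T s) = 0" "lorentz (N s) (N1 s) = 0"
    "lorentz (N s) (N2 s) = 0" "lorentz (T s) (N1 s) = 0" "lorentz (T s) (N2 s) = 0"
    "lorentz (N1 s) (N2 s) = 0"
proof -
  show NN: "lorentz (N s) (N s) = -1" and TT: "lorentz (T s) (T s) = 1" and NT: "lorentz (N s) (T s) = 0"
    by (simp_all add: normal_unit tangent_unit normal_tangent s)
  have "lorentz (V s) (V s) = (k_g n \<gamma> s)\<^sup>2"
    using k_g_sqrt[OF s] spacelike_V[OF s] by (simp add: spacelike_def)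
  then show N1N1: "lorentz (N1 s) (N1 s) = 1"
    using k_g_nonzero[OF s]
    by (simp add: N1_V lorentz.scaleR_left lorentz.scaleR_right power2_eq_square field_simps)
  show NN1: "lorentz (N s) (N1 s) = 0"
    using lorentz_N_V[OF s] by (simp add: N1_V lorentz.scaleR_right)
  show TN1: "lorentz (T s) (N1 s) = 0"
    using lorentz_T_T'[OF s] NT
    by (simp add: N1_V V_def lorentz.scaleR_right lorentz.diff_right lorentz_commute[of "T s" "N s"])
  show "lorentz (N s) (N2 s) = 0" "lorentz (T s) (N2 s) = 0" "lorentz (N1 s) (N2 s) = 0"
    unfolding n_2_def by (rule lorentz_wedge)+
  show "lorentz (N2 s) (N2 s) = 1"
    unfolding n_2_def lorentz_wedge_wedge by (simp add: NN TT N1N1 NT NN1 TN1)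
qed

lemma frame_eqI:
  assumes "s \<in> I" "lorentz (N s) u = lorentz (N s) v" "lorentz (T s) u = lorentz (T s) v"
    "lorentz (N1 s) u = lorentz (N1 s) v" "lorentz (N2 s) u = lorentz (N2 s) v"
  shows "u = v"
proof -
  have "u - v = 0"
    by (rule pseudo_orthonormal_eq_0I[of "N s" "T s" "N1 s"])
      (use assms orthonormal[OF assms(1)] in \<open>auto simp: timelike_def lorentz.diff_right simp flip: n_2_def\<close>)
  then show ?thesis by simp
qed

text \<open>
  Each derivative is identified by its products with the frame. Some of these products are the
  invariants by definition; the others follow by differentiating the orthonormality relations.
\<close>
lemma frame_derivatives:
  assumes s: "s \<in> I"
  shows "vector_derivative N (at s)
      = k_n n \<gamma> s *\<^sub>R T s + \<tau>_1 n \<gamma> s *\<^sub>R N1 s + \<tau>_2 n \<gamma> s *\<^sub>R N2 s"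
    and "T' s = k_n n \<gamma> s *\<^sub>R N s + k_g n \<gamma> s *\<^sub>R N1 s"
    and "vector_derivative N1 (at s)
      = \<tau>_1 n \<gamma> s *\<^sub>R N s - k_g n \<gamma> s *\<^sub>R T s + \<tau>_g n \<gamma> s *\<^sub>R N2 s"
    and "vector_derivative N2 (at s) = \<tau>_2 n \<gamma> s *\<^sub>R N s - \<tau>_g n \<gamma> s *\<^sub>R N1 s"
proof -
  note o = orthonormal[OF s]
  note o' = o(5-10)[THEN trans[OF lorentz_commute]]
  note expand = lorentz.add_right lorentz.diff_right lorentz.scaleR_right o o'
  note d = derivs[OF s]
  note c = lorentz_constant_deriv[OF open_I s]
  let ?N' = "vector_derivative N (at s)" and ?N1' = "vector_derivative N1 (at s)"
    and ?N2' = "vector_derivative N2 (at s)"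
  show T': "T' s = k_n n \<gamma> s *\<^sub>R N s + k_g n \<gamma> s *\<^sub>R N1 s"
    using k_g_nonzero[OF s] by (simp add: N1_V V_def)
  have T'N1: "lorentz (N1 s) (T' s) = k_g n \<gamma> s" and T'N2: "lorentz (N2 s) (T' s) = 0"
    unfolding T' by (simp_all add: expand)
  have kn: "lorentz (N s) (T' s) = - k_n n \<gamma> s" by (simp add: k_n_def)
  have t1: "lorentz (N1 s) ?N' = \<tau>_1 n \<gamma> s" by (simp add: \<tau>_1_def)
  have t2: "lorentz (N2 s) ?N' = \<tau>_2 n \<gamma> s" by (simp add: \<tau>_2_def)
  have tg: "lorentz (N1 s) ?N2' = - \<tau>_g n \<gamma> s" by (simp add: \<tau>_g_def lorentz_commute)
  have NN': "lorentz (N s) ?N' = 0"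
    using c[OF d(1) d(1) orthonormal(1)] by (simp add: lorentz_commute[of ?N'])
  have TN': "lorentz (T s) ?N' = k_n n \<gamma> s"
    using c[OF d(1) d(2) orthonormal(5)] kn by (simp add: lorentz_commute[of ?N'])
  have NN1': "lorentz (N s) ?N1' = - \<tau>_1 n \<gamma> s"
    using c[OF d(1) d(3) orthonormal(6)] t1 by (simp add: lorentz_commute[of ?N'])
  have TN1': "lorentz (T s) ?N1' = - k_g n \<gamma> s"
    using c[OF d(2) d(3) orthonormal(8)] T'N1 by (simp add: lorentz_commute[of "T' s"])
  have N1N1': "lorentz (N1 s) ?N1' = 0"
    using c[OF d(3) d(3) orthonormal(3)] by (simp add: lorentz_commute[of ?N1'])
  have N2N1': "lorentz (N2 s) ?N1' = \<tau>_g n \<gamma> s"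
    using c[OF d(3) d(4) orthonormal(10)] tg by (simp add: lorentz_commute[of ?N1'])
  have NN2': "lorentz (N s) ?N2' = - \<tau>_2 n \<gamma> s"
    using c[OF d(1) d(4) orthonormal(7)] t2 by (simp add: lorentz_commute[of ?N'])
  have TN2': "lorentz (T s) ?N2' = 0"
    using c[OF d(2) d(4) orthonormal(9)] T'N2 by (simp add: lorentz_commute[of "T' s"])
  have N2N2': "lorentz (N2 s) ?N2' = 0"
    using c[OF d(4) d(4) orthonormal(4)] by (simp add: lorentz_commute[of ?N2'])
  show "?N' = k_n n \<gamma> s *\<^sub>R T s + \<tau>_1 n \<gamma> s *\<^sub>R N1 s + \<tau>_2 n \<gamma> s *\<^sub>R N2 s"
    by (rule frame_eqI[OF s]) (simp_all add: expand NN' TN' t1 t2)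
  show "?N1' = \<tau>_1 n \<gamma> s *\<^sub>R N s - k_g n \<gamma> s *\<^sub>R T s + \<tau>_g n \<gamma> s *\<^sub>R N2 s"
    by (rule frame_eqI[OF s]) (simp_all add: expand NN1' TN1' N1N1' N2N1')
  show "?N2' = \<tau>_2 n \<gamma> s *\<^sub>R N s - \<tau>_g n \<gamma> s *\<^sub>R N1 s"
    by (rule frame_eqI[OF s]) (simp_all add: expand NN2' TN2' tg N2N2')
qed

text \<open>
  The link to the abstract frame, in which the three conditions are compared.
\<close>
lemma is_lorentz_frame:
  assumes "\<And>s. s \<in> I \<Longrightarrow> (k_n n \<gamma> s)\<^sup>2 < (k_g n \<gamma> s)\<^sup>2"
  shows "lorentz_frame I N T N1 N2 (k_n n \<gamma>) (k_g n \<gamma>) (\<tau>_1 n \<gamma>) (\<tau>_2 n \<gamma>) (\<tau>_g n \<gamma>)"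
proof
  fix s assume s: "s \<in> I"
  note d = derivs[OF s, unfolded frame_derivatives[OF s]]
  show "(N has_vector_derivative
      k_n n \<gamma> s *\<^sub>R T s + \<tau>_1 n \<gamma> s *\<^sub>R N1 s + \<tau>_2 n \<gamma> s *\<^sub>R N2 s) (at s)"
    "(T has_vector_derivative k_n n \<gamma> s *\<^sub>R N s + k_g n \<gamma> s *\<^sub>R N1 s) (at s)"
    "(N1 has_vector_derivative
      \<tau>_1 n \<gamma> s *\<^sub>R N s - k_g n \<gamma> s *\<^sub>R T s + \<tau>_g n \<gamma> s *\<^sub>R N2 s) (at s)"
    "(N2 has_vector_derivative \<tau>_2 n \<gamma> s *\<^sub>R N s - \<tau>_g n \<gamma> s *\<^sub>R N1 s) (at s)"
    by (fact d)+
  show "v = 0" if "lorentz (N s) v = 0" "lorentz (T s) v = 0" "lorentz (N1 s) v = 0"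
      "lorentz (N2 s) v = 0" for v
    using that by (intro frame_eqI[OF s]) (simp_all add: lorentz.zero_right)
qed (use open_I interval_I orthonormal smooth_k_n smooth_k_g smooth_torsions assms in auto)

end

section \<open>The three equivalent conditions\<close>

theorem proposition3p6:
  fixes U :: "(real ^ 3) set" and X :: "real ^ 3 \<Rightarrow> real ^ 4" and M :: "(real ^ 4) set"
    and n :: "real ^ 4 \<Rightarrow> real ^ 4"
    and I :: "real set" and \<gamma>b :: "real \<Rightarrow> real ^ 3" and \<gamma> :: "real \<Rightarrow> real ^ 4"
    and \<theta> :: "real \<Rightarrow> real"
  assumes "open U" and "spacelike_embedding_on U X" and "M = X ` U"
    and "future_unit_normal U X n"
    and "open I" and "is_interval I" and "I \<noteq> {}"
    and "smooth_on I \<gamma>b" and "\<gamma>b ` I \<subseteq> U"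
    and "\<forall>s\<in>I. vector_derivative \<gamma>b (at s) \<noteq> 0"
    and "\<forall>s\<in>I. \<gamma> s = X (\<gamma>b s)"
    and "\<forall>s\<in>I. lorentz_norm (tangent \<gamma> s) = 1"
    and "\<forall>s\<in>I. k_g n \<gamma> s \<noteq> 0"
    and "\<forall>s\<in>I. k_n n \<gamma> s * \<tau>_2 n \<gamma> s + k_g n \<gamma> s * \<tau>_g n \<gamma> s \<noteq> 0"
    and "\<forall>s\<in>I. (k_g n \<gamma> s)\<^sup>2 > (k_n n \<gamma> s)\<^sup>2"
    and "\<forall>s\<in>I. singular_tanh n \<gamma> s \<in> {-1<..<1}"
    and "\<forall>s\<in>I. tanh (\<theta> s) = singular_tanh n \<gamma> s"
    and "{p \<in> I \<times> UNIV. singular_point (hyperbolic_surface n \<gamma>) p} = {(s, \<theta> s) | s. s \<in> I}"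
  shows "((\<exists>w. timelike w \<and> (\<forall>s\<in>I. hyperbolic_surface n \<gamma> (s, \<theta> s) = w)) \<longleftrightarrow>
          (\<forall>s\<in>I. \<rho> n \<gamma> s = 0))
       \<and> ((\<forall>s\<in>I. \<rho> n \<gamma> s = 0) \<longleftrightarrow>
          (\<exists>v c. timelike v \<and> \<gamma> ` I \<subseteq> M \<inter> HP v c))"
proof -
  note U = \<open>open U\<close> and X = \<open>spacelike_embedding_on U X\<close> and n = \<open>future_unit_normal U X n\<close>
    and I = \<open>open I\<close> and \<gamma>b = \<open>smooth_on I \<gamma>b\<close> \<open>\<gamma>b ` I \<subseteq> U\<close>
  have \<gamma>: "\<gamma> s = X (\<gamma>b s)" "\<gamma>b s \<in> U" if "s \<in> I" for s
    using that assms(9,11) by auto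
  have sX: "smooth_on U X" using X by (auto simp: spacelike_embedding_on_def smooth_embedding_on_def)
  have s\<gamma>: "smooth_on I \<gamma>"
    by (rule smooth_on_cong[OF I smooth_on_compose[OF I \<gamma>b(1) sX \<gamma>b(2)]]) (simp add: \<gamma>)
  have tangent: "tangent \<gamma> s = frechet_derivative X (at (\<gamma>b s)) (vector_derivative \<gamma>b (at s))"
    if s: "s \<in> I" for s
  proof -
    have "((\<lambda>s. X (\<gamma>b s)) has_vector_derivative
        frechet_derivative X (at (\<gamma>b s)) (vector_derivative \<gamma>b (at s))) (at s)"
      using vector_derivative_diff_chain_within[OF smooth_on_has_vector_derivative[OF \<gamma>b(1) s]
          has_derivative_at_withinI[OF smooth_on_has_derivative[OF sX \<gamma>(2)[OF s]]]]
      by (simp add: o_def)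
    then have "(\<gamma> has_vector_derivative
        frechet_derivative X (at (\<gamma>b s)) (vector_derivative \<gamma>b (at s))) (at s)"
      by (rule has_vector_derivative_transform_within_open[OF _ I s]) (simp add: \<gamma>)
    then show ?thesis by (simp add: tangent_def vector_derivative_at)
  qed
  interpret unit_speed_curve I n \<gamma>
  proof
    show "smooth_on I (\<lambda>s. n (\<gamma> s))"
      by (rule smooth_on_cong[OF I smooth_on_compose[OF I \<gamma>b(1) smooth_on_future_unit_normal[OF U X n] \<gamma>b(2)]])
        (simp add: \<gamma>)
    fix s assume s: "s \<in> I"
    show "lorentz (n (\<gamma> s)) (n (\<gamma> s)) = -1"
      using n \<gamma>[OF s] by (simp add: future_unit_normal_def unit_timelike)
    show "lorentz (n (\<gamma> s)) (tangent \<gamma> s) = 0"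
      using n \<gamma>[OF s] tangent[OF s] by (simp add: future_unit_normal_def)
    show "lorentz (tangent \<gamma> s) (tangent \<gamma> s) = 1"
      using spacelike_embedding_frechet_spacelike[OF X \<gamma>(2)[OF s]] assms(10,12) s
      by (intro unit_spacelike) (simp_all add: tangent)
  qed (use assms s\<gamma> in auto)
  interpret lorentz_frame I N T N1 N2 "k_n n \<gamma>" "k_g n \<gamma>" "\<tau>_1 n \<gamma>" "\<tau>_2 n \<gamma>" "\<tau>_g n \<gamma>"
    by (rule is_lorentz_frame) (use assms(15) in blast)
  interpret lorentz_frame_angle I N T N1 N2 "k_n n \<gamma>" "k_g n \<gamma>" "\<tau>_1 n \<gamma>" "\<tau>_2 n \<gamma>" "\<tau>_g n \<gamma>" \<theta>
    by unfold_locales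
      (use assms(14,17) in \<open>auto simp: A_def B_def r_def singular_tanh_def Let_def\<close>)
  have S: "hyperbolic_surface n \<gamma> (s, \<theta> s) = S s" for s
    by (simp add: hyperbolic_surface_def S_def E_def r_def algebra_simps)
  have \<rho>: "\<rho> n \<gamma> s = rho s" for s
    by (simp add: \<rho>_def rho_def A_def B_def Let_def)
  have "timelike w" if w: "\<forall>s\<in>I. S s = w" for w
    using \<open>I \<noteq> {}\<close> w lorentz_S_S by (fastforce simp: timelike_def)
  then have 1: "(\<exists>w. timelike w \<and> (\<forall>s\<in>I. S s = w)) \<longleftrightarrow> (\<forall>s\<in>I. rho s = 0)"
    unfolding constant_iff_rho[symmetric] by blast
  have "\<gamma> ` I \<subseteq> M" using assms(3) \<gamma> by auto
  then have 2: "(\<forall>s\<in>I. rho s = 0) \<longleftrightarrow> (\<exists>v c. timelike v \<and> \<gamma> ` I \<subseteq> M \<inter> HP v c)"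
    using hyperplane_iff_rho[OF \<open>I \<noteq> {}\<close> curve_deriv] by simp
  show ?thesis unfolding S \<rho> using 1 2 by (rule conjI)
qed

end
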